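(* Let $S$ be a Cu-semigroup satisfying (O5) and weak cancellation. Let $L=\bigoplus_{j=1}^rL_j$ with $L_j=\mathrm{Lsc}([0,1],\overline{\mathbb{N}})$ for each $j$, and let $\varphi_i\colon L\to S$, $i\ge1$, be a sequence of Cu-morphisms with $\varphi_i(1_j)=\varphi_{i+1}(1_j)$ for all $i,j$, such that $d(\varphi_i,\varphi_{i+1})<\epsilon_i$ with $(\epsilon_i)_i$ strictly decreasing and $\sum_{i=1}^\infty\epsilon_i<\infty$. Then there exists a unique Cu-morphism $\varphi\colon L\to S$ satisfying $d(\varphi,\varphi_i)\to0$ and $\varphi(1_j)=\varphi_i(1_j)$ for every $j\le r$ and every $i$.
   Context: A positively ordered monoid is a commutative monoid $S$ with a partial order compatible with addition such that $0\le x$ for all $x\in S$. For $x,y\in S$ write $x\ll y$ if for every increasing sequence $(z_n)_n$ in $S$ whose supremum exists and satisfies $y\le \sup_n z_n$, there is $n$ with $x\le z_n$. A Cu-semigroup is a positively ordered monoid $S$ such that: (O1) every increasing sequence in $S$ has a supremum; (O2) every element is the supremum of a $\ll$-increasing sequence; (O3) $x'\ll x$ and $y'\ll y$ imply $x'+y'\ll x+y$; (O4) $\sup_n x_n+\sup_n y_n=\sup_n(x_n+y_n)$ for all increasing sequences $(x_n)_n,(y_n)_n$. A Cu-morphism is a map between Cu-semigroups preserving $0$, addition, order, the relation $\ll$, and suprema of increasing sequences. (O5): whenever $x+y\le z$, $x'\ll x$ and $y'\ll y$, there exists $c$ with $x'+c\le z\le x+c$ and $y'\ll c$. Weak cancellation: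 $x+z\ll y+z$ implies $x\ll y$. $\overline{\mathbb{N}}=\{0,1,2,\dots\}\cup\{\infty\}$, and $\mathrm{Lsc}([0,1],\overline{\mathbb{N}})$ is the Cu-semigroup of lower-semicontinuous functions $[0,1]\to\overline{\mathbb{N}}$ with pointwise order and addition; $\chi_U$ is the indicator function of $U$ (with $\chi_{(t,1]}=0$ if $t\ge1$). Direct sums carry componentwise order and addition; $1_j\in L$ has $j$-th component the constant function $1$ and all other components $0$. Distance: for Cu-morphisms $\varphi_1,\varphi_2\colon \mathrm{Lsc}([0,1],\overline{\mathbb{N}})\to S$ with $\varphi_1(1)=\varphi_2(1)$, $d(\varphi_1,\varphi_2)$ is the infimum of all $\epsilon\in[0,1]$ such that $\varphi_1(\chi_{(t+\epsilon,1]})\le\varphi_2(\chi_{(t,1]})$ and $\varphi_2(\chi_{(t+\epsilon,1]})\le\varphi_1(\chi_{(t,1]})$ for all $t\in[0,1]$. For Cu-morphisms $\varphi_1,\varphi_2\colon L\to S$ with $\varphi_1(1_j)=\varphi_2(1_j)$ for all $j$, $d(\varphi_1,\varphi_2)=\sup_{j\le r}d(\varphi_1|_{L_j},\varphi_2|_{L_j})$. *)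

theory Defs
  imports
    "HOL-Analysis.Analysis"
    "HOL-Library.Extended_Nat"
    "HOL-Library.Function_Algebras"
begin

class pos_ordered_monoid = ordered_comm_monoid_add +
  assumes zero_least: "0 \<le> x"

context order
begin

abbreviation increasing :: "(nat \<Rightarrow> 'a) \<Rightarrow> bool"
  where "increasing z \<equiv> monotone (\<le>) (\<le>) z"

definition seq_sup :: "(nat \<Rightarrow> 'a) \<Rightarrow> 'a \<Rightarrow> bool"
  where "seq_sup z s \<longleftrightarrow> (\<forall>n. z n \<le> s) \<and> (\<forall>u. (\<forall>n. z n \<le> u) \<longrightarrow> s \<le> u)"

definition way_below :: "'a \<Rightarrow> 'a \<Rightarrow> bool"  (infix \<open>\<lless>\<close> 50)
  where "x \<lless> y \<longleftrightarrow>
    (\<forall>z s. increasing z \<longrightarrow> seq_sup z s \<longrightarrow> y \<le> s \<longrightarrow> (\<exists>n. x \<le> z n))"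

end

class cu_semigroup = pos_ordered_monoid +
  assumes O1: "increasing z \<Longrightarrow> \<exists>s. seq_sup z s"
    and O2: "\<exists>z. (\<forall>n. z n \<lless> z (Suc n)) \<and> seq_sup z x"
    and O3: "x' \<lless> x \<Longrightarrow> y' \<lless> y \<Longrightarrow> x' + y' \<lless> x + y"
    and O4: "increasing u \<Longrightarrow> increasing v \<Longrightarrow> seq_sup u s \<Longrightarrow> seq_sup v t
      \<Longrightarrow> seq_sup (\<lambda>n. u n + v n) (s + t)"

definition axiom_O5 :: "'a::cu_semigroup itself \<Rightarrow> bool"
  where "axiom_O5 _ \<longleftrightarrow>
    (\<forall>x y z x' y' :: 'a. x + y \<le> z \<longrightarrow> x' \<lless> x \<longrightarrow> y' \<lless> y \<longrightarrow>
      (\<exists>c. x' + c \<le> z \<and> z \<le> x + c \<and> y' \<lless> c))"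

definition weak_cancellation :: "'a::cu_semigroup itself \<Rightarrow> bool"
  where "weak_cancellation _ \<longleftrightarrow> (\<forall>x y z :: 'a. x + z \<lless> y + z \<longrightarrow> x \<lless> y)"

(* The sort only provides the structure mentioned in the conditions; that the source and
   target satisfy O1-O4 is a property of the types the predicate is applied to. *)
definition cu_morphism :: "('a::pos_ordered_monoid \<Rightarrow> 'b::pos_ordered_monoid) \<Rightarrow> bool"
  where "cu_morphism f \<longleftrightarrow>
    f 0 = 0 \<and>
    (\<forall>x y. f (x + y) = f x + f y) \<and>
    (\<forall>x y. x \<le> y \<longrightarrow> f x \<le> f y) \<and>
    (\<forall>x y. x \<lless> y \<longrightarrow> f x \<lless> f y) \<and>
    (\<forall>z s. increasing z \<longrightarrow> seq_sup z s \<longrightarrow> seq_sup (\<lambda>n. f (z n)) (f s))"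

definition lower_semicontinuous_on :: "'a::topological_space set \<Rightarrow> ('a \<Rightarrow> enat) \<Rightarrow> bool"
  where "lower_semicontinuous_on A f \<longleftrightarrow>
    (\<forall>c. openin (top_of_set A) {x \<in> A. c < f x})"

lemma lower_semicontinuous_on_add:
  assumes "lower_semicontinuous_on A f" "lower_semicontinuous_on A g"
  shows "lower_semicontinuous_on A (\<lambda>x. f x + g x)"
  unfolding lower_semicontinuous_on_def
proof
  fix c :: enat
  have ge: "openin (top_of_set A) {x \<in> A. enat a \<le> h x}"
    if "lower_semicontinuous_on A h" for h :: "'a \<Rightarrow> enat" and a
  proof (cases a)
    case 0
    have "{x \<in> A. enat a \<le> h x} = A"
      using 0 by (auto simp: zero_enat_def[symmetric])
    then show ?thesis by simp
  next
    case (Suc k)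
    have "{x \<in> A. enat a \<le> h x} = {x \<in> A. enat k < h x}"
      using Suc by (auto simp: Suc_ile_eq)
    then show ?thesis using that by (simp add: lower_semicontinuous_on_def)
  qed
  have split: "\<exists>a b. c < enat (a + b) \<and> enat a \<le> u \<and> enat b \<le> v"
    if cuv: "c < u + v" for u v :: enat
  proof -
    obtain n where n: "c = enat n" using cuv by (cases c) auto
    show ?thesis
    proof (cases u)
      case (enat i)
      show ?thesis
      proof (cases v)
        case (enat j)
        with \<open>u = enat i\<close> cuv show ?thesis by auto
      next
        case infinity
        with n show ?thesis by (intro exI[of _ 0] exI[of _ "Suc n"]) (auto simp: zero_enat_def[symmetric])
      qed
    next
      case infinity
      with n show ?thesis by (intro exI[of _ "Suc n"] exI[of _ 0]) (auto simp: zero_enat_def[symmetric])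
    qed
  qed
  have "{x \<in> A. c < f x + g x} =
    (\<Union>(a, b) \<in> {(a, b). c < enat (a + b)}. {x \<in> A. enat a \<le> f x} \<inter> {x \<in> A. enat b \<le> g x})"
    (is "?L = ?R")
  proof
    show "?L \<subseteq> ?R" using split by fast
    show "?R \<subseteq> ?L"
    proof
      fix x assume "x \<in> ?R"
      then obtain a b where ab: "c < enat (a + b)" "x \<in> A" "enat a \<le> f x" "enat b \<le> g x"
        by auto
      have "enat a + enat b \<le> f x + g x" using ab by (intro add_mono) auto
      with ab(1) have "c < f x + g x" by (simp add: less_le_trans)
      with ab(2) show "x \<in> ?L" by simp
    qed
  qed
  moreover have "openin (top_of_set A) ?R"
    using ge[OF assms(1)] ge[OF assms(2)] by (intro openin_Union) auto
  ultimately show "openin (top_of_set A) ?L" by simp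
qed

lemma lower_semicontinuous_on_indicator:
  assumes "openin (top_of_set A) (A \<inter> U)"
  shows "lower_semicontinuous_on A (indicator (A \<inter> U))"
  unfolding lower_semicontinuous_on_def
proof
  fix c :: enat
  have "{x \<in> A. c < indicator (A \<inter> U) x} = (if c = 0 then A \<inter> U else {})"
    by (auto simp: indicator_def one_enat_def zero_enat_def enat_0_iff split: if_splits)
       (cases c; auto)+
  then show "openin (top_of_set A) {x \<in> A. c < indicator (A \<inter> U) x}"
    using assms by auto
qed

(* Functions on [0,1] are encoded as functions on the reals vanishing outside [0,1]. *)
typedef lsc01 = "{f :: real \<Rightarrow> enat.
    lower_semicontinuous_on {0..1} f \<and> (\<forall>x. x \<notin> {0..1} \<longrightarrow> f x = 0)}"
  by (rule exI[of _ "\<lambda>_. 0"]) (auto simp: lower_semicontinuous_on_def)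

setup_lifting type_definition_lsc01

instantiation lsc01 :: pos_ordered_monoid
begin

lift_definition zero_lsc01 :: lsc01 is "\<lambda>_. 0"
  by (auto simp: lower_semicontinuous_on_def)

lift_definition plus_lsc01 :: "lsc01 \<Rightarrow> lsc01 \<Rightarrow> lsc01" is "\<lambda>f g x. f x + g x"
  by (auto intro: lower_semicontinuous_on_add)

lift_definition less_eq_lsc01 :: "lsc01 \<Rightarrow> lsc01 \<Rightarrow> bool" is "\<lambda>f g. \<forall>x. f x \<le> g x" .

definition less_lsc01 :: "lsc01 \<Rightarrow> lsc01 \<Rightarrow> bool"
  where "less_lsc01 f g \<longleftrightarrow> f \<le> g \<and> \<not> g \<le> f"

instance
proof
  fix f g h :: lsc01
  show "f < g \<longleftrightarrow> f \<le> g \<and> \<not> g \<le> f" by (rule less_lsc01_def)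
  show "f \<le> f" by transfer simp
  show "f \<le> g \<Longrightarrow> g \<le> h \<Longrightarrow> f \<le> h" by transfer (meson order_trans)
  show "f \<le> g \<Longrightarrow> g \<le> f \<Longrightarrow> f = g" by transfer (auto intro: antisym)
  show "f + g + h = f + (g + h)" by transfer (simp add: add.assoc)
  show "f + g = g + f" by transfer (simp add: add.commute)
  show "0 + f = f" by transfer simp
  show "f \<le> g \<Longrightarrow> h + f \<le> h + g" by transfer (simp add: add_left_mono)
  show "0 \<le> f" by transfer simp
qed

end

instance "fun" :: (type, pos_ordered_monoid) pos_ordered_monoid
  by standard (simp add: le_fun_def zero_least)

lift_definition chi_above :: "real \<Rightarrow> lsc01" is "\<lambda>t. indicator ({0..1} \<inter> {t<..})"
  by (auto intro!: lower_semicontinuous_on_indicator openin_open_Int)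

lift_definition lsc_unit :: lsc01 is "indicator ({0..1} \<inter> UNIV)"
  by (rule conjI, rule lower_semicontinuous_on_indicator) auto

(* The direct sum of r copies of Lsc([0,1]) is 'r \<Rightarrow> lsc01 with 'r a finite index type; the
   pointwise order and addition on functions are the componentwise ones. *)
definition summand_incl :: "'r \<Rightarrow> lsc01 \<Rightarrow> ('r \<Rightarrow> lsc01)"
  where "summand_incl j f = (\<lambda>i. if i = j then f else 0)"

definition unit_at :: "'r \<Rightarrow> ('r \<Rightarrow> lsc01)"
  where "unit_at j = summand_incl j lsc_unit"

definition cu_dist_interval :: "(lsc01 \<Rightarrow> 's::order) \<Rightarrow> (lsc01 \<Rightarrow> 's) \<Rightarrow> real"
  where "cu_dist_interval \<phi> \<psi> = Inf {\<epsilon> \<in> {0..1}. \<forall>t \<in> {0..1}.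
    \<phi> (chi_above (t + \<epsilon>)) \<le> \<psi> (chi_above t) \<and> \<psi> (chi_above (t + \<epsilon>)) \<le> \<phi> (chi_above t)}"

(* Meaningful only for Cu-morphisms that agree on every unit_at j. *)
definition cu_dist ::
    "(('r::finite \<Rightarrow> lsc01) \<Rightarrow> 's::order) \<Rightarrow> (('r \<Rightarrow> lsc01) \<Rightarrow> 's) \<Rightarrow> real"
  where "cu_dist \<phi> \<psi> =
    (SUP j. cu_dist_interval (\<phi> \<circ> summand_incl j) (\<psi> \<circ> summand_incl j))"

end

theory Submission
  imports Defs
begin

text \<open>Cap a function \<open>f\<close> at \<open>n\<close> and replace its value at \<open>x\<close> by the infimum over the closed ball of
  radius \<open>d > 0\<close>. The shrunk function is way below \<open>f\<close>, and \<open>f\<close> is the supremum of such functions.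
  If \<open>\<phi>\<close> and \<open>\<psi>\<close> agree on the units and have distance less than \<open>d\<close>, then \<open>\<phi>\<close> of \<open>f\<close> shrunk by \<open>d\<close> is at
  most \<open>\<psi> f\<close>: for the rays \<open>(t, 1]\<close> this is the definition of the distance, cancelling a ray
  \<open>(s, 1]\<close> from the unit gives the rays \<open>[0, t)\<close>, and cancelling the unit from the sum of the
  indicators of \<open>[0, b)\<close> and \<open>(a, 1]\<close> gives the intervals \<open>(a, b)\<close>; components and superlevel sets
  give the general case. With \<open>\<delta> n\<close> the tail sums of \<open>\<epsilon>\<close>, the images under \<open>\<phi> n\<close> of \<open>f\<close> capped at \<open>n\<close>
  and shrunk by \<open>2 * \<delta> n\<close> therefore increase, and their supremum is the limit morphism. The factor 2
  leaves room to shrink once more inside \<open>f\<close>.\<close>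

section \<open>Suprema and the way-below relation\<close>

lemma seq_supI:
  assumes "\<And>n. z n \<le> s" and "\<And>u. (\<And>n. z n \<le> u) \<Longrightarrow> s \<le> u"
  shows "seq_sup z (s::'a::order)"
  using assms by (simp add: seq_sup_def)

lemma seq_sup_upper: "seq_sup z s \<Longrightarrow> z n \<le> (s::'a::order)"
  by (simp add: seq_sup_def)

lemma seq_sup_least: "seq_sup z s \<Longrightarrow> (\<And>n. z n \<le> u) \<Longrightarrow> s \<le> (u::'a::order)"
  by (simp add: seq_sup_def)

lemma seq_sup_unique: "seq_sup z s \<Longrightarrow> seq_sup z t \<Longrightarrow> s = (t::'a::order)"
  by (simp add: seq_sup_def order.antisym)

lemma seq_sup_fun_iff:
  fixes s :: "'b \<Rightarrow> 'a::order"
  shows "seq_sup z s \<longleftrightarrow> (\<forall>j. seq_sup (\<lambda>n. z n j) (s j))"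
proof
  assume z: "seq_sup z s"
  show "\<forall>j. seq_sup (\<lambda>n. z n j) (s j)"
  proof (intro allI seq_supI)
    fix j n show "z n j \<le> s j" using seq_sup_upper[OF z] by (simp add: le_fun_def)
  next
    fix j u assume u: "\<And>n. z n j \<le> u"
    \<comment> \<open>Altering \<open>s\<close> in component \<open>j\<close> alone still gives an
      upper bound of \<open>z\<close>, so leastness of \<open>s\<close> can be read off in that
      component.\<close>
    have "s \<le> s(j := u)"
      using seq_sup_upper[OF z] u by (intro seq_sup_least[OF z]) (simp add: le_fun_def)
    then show "s j \<le> u" by (simp add: le_fun_def split: if_splits)
  qed
qed (simp add: seq_sup_def le_fun_def)

lemma way_belowD:
  "x \<lless> y \<Longrightarrow> increasing z \<Longrightarrow> seq_sup z s \<Longrightarrow> y \<le> s \<Longrightarrow> \<exists>n. x \<le> (z n :: 'a::order)"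
  by (auto simp: way_below_def)

lemma le_way_below_trans: "x \<le> y \<Longrightarrow> y \<lless> z \<Longrightarrow> x \<lless> (z::'a::order)"
  unfolding way_below_def by (meson order_trans)

lemma way_below_le_trans: "x \<lless> y \<Longrightarrow> y \<le> z \<Longrightarrow> x \<lless> (z::'a::order)"
  unfolding way_below_def by (meson order_trans)

lemma way_below_imp_le:
  assumes "x \<lless> y" shows "x \<le> (y::'a::order)"
proof -
  have "\<exists>n::nat. x \<le> y"
    by (rule way_belowD[OF assms, of "\<lambda>_. y" y]) (auto simp: monotone_def seq_sup_def)
  then show ?thesis by simp
qed

lemma zero_way_below: "0 \<lless> (y::'a::pos_ordered_monoid)"
  by (auto simp: way_below_def zero_least)

section \<open>Cu-morphisms\<close>

context
  fixes f :: "'a::pos_ordered_monoid \<Rightarrow> 'b::pos_ordered_monoid"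
  assumes f: "cu_morphism f"
begin

lemma cu_morphism_zero: "f 0 = 0"
  and cu_morphism_add: "f (x + y) = f x + f y"
  and cu_morphism_mono: "x \<le> y \<Longrightarrow> f x \<le> f y"
  and cu_morphism_way_below: "x \<lless> y \<Longrightarrow> f x \<lless> f y"
  and cu_morphism_sup: "increasing z \<Longrightarrow> seq_sup z s \<Longrightarrow> seq_sup (\<lambda>n. f (z n)) (f s)"
  using f by (auto simp: cu_morphism_def)

lemma cu_morphism_sum: "f (sum h A) = (\<Sum>i\<in>A. f (h i))"
  by (induction A rule: infinite_finite_induct) (auto simp: cu_morphism_zero cu_morphism_add)

end

lemma cu_morphism_comp: "cu_morphism f \<Longrightarrow> cu_morphism g \<Longrightarrow> cu_morphism (f \<circ> g)"
  by (auto simp: cu_morphism_def monotone_def)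

section \<open>Lower semicontinuous functions on the unit interval\<close>

lemma Rep_outside: "x \<notin> {0..1} \<Longrightarrow> Rep_lsc01 f x = 0"
  using Rep_lsc01[of f] by auto

lemma openin_superlevel: "openin (top_of_set {0..1}) {x \<in> {0..1}. c < Rep_lsc01 f x}"
  using Rep_lsc01[of f] by (auto simp: lower_semicontinuous_on_def)

lemma lsc01_leI:
  assumes "\<And>x. x \<in> {0..1} \<Longrightarrow> Rep_lsc01 f x \<le> Rep_lsc01 g x"
  shows "f \<le> g"
  unfolding less_eq_lsc01.rep_eq
proof
  fix x show "Rep_lsc01 f x \<le> Rep_lsc01 g x"
    using assms Rep_outside[of x f] by (cases "x \<in> {0..1}") auto
qed

text \<open>Finite levels suffice even when \<open>v\<close> is \<infinity>, since a failure makes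
  \<open>w\<close> finite and \<open>w\<close> itself is then a separating level. Order between
  functions thus becomes inclusion of superlevel sets.\<close>

lemma enat_le_if_levels:
  assumes "\<And>c. enat c < v \<Longrightarrow> enat c < w" shows "v \<le> w"
proof (rule ccontr)
  assume "\<not> v \<le> w"
  moreover from this obtain c where "w = enat c" by (cases w) auto
  ultimately show False using assms[of c] by (simp add: not_le)
qed

lemma lsc01_le_if_levels:
  assumes "\<And>x c. x \<in> {0..1} \<Longrightarrow> enat c < Rep_lsc01 f x \<Longrightarrow> enat c < Rep_lsc01 g x"
  shows "f \<le> g"
  using assms by (intro lsc01_leI enat_le_if_levels)

lemma lsc01_levelD: "f \<le> g \<Longrightarrow> c < Rep_lsc01 f x \<Longrightarrow> c < Rep_lsc01 g x"
  by (meson less_eq_lsc01.rep_eq less_le_trans)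

text \<open>The pointwise supremum is lower semicontinuous, its superlevel sets being unions of open
  sets. It is therefore an upper bound within \<open>lsc01\<close>, and the abstract supremum cannot
  exceed it.\<close>

lemma seq_sup_lsc01_level:
  assumes z: "seq_sup z s" and c: "c < Rep_lsc01 s x"
  shows "\<exists>n. c < Rep_lsc01 (z n) x"
proof -
  define u where "u = Abs_lsc01 (\<lambda>x. SUP n. Rep_lsc01 (z n) x)"
  have "{x \<in> {0..1}. d < (SUP n. Rep_lsc01 (z n) x)} = (\<Union>n. {x \<in> {0..1}. d < Rep_lsc01 (z n) x})" for d
    by (auto simp: less_SUP_iff)
  then have "lower_semicontinuous_on {0..1} (\<lambda>x. SUP n. Rep_lsc01 (z n) x)"
    unfolding lower_semicontinuous_on_def by (auto simp only: intro!: openin_Union openin_superlevel)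
  then have u: "Rep_lsc01 u x = (SUP n. Rep_lsc01 (z n) x)" for x
    unfolding u_def by (subst Abs_lsc01_inverse) (auto simp: Rep_outside)
  have "s \<le> u"
    by (rule seq_sup_least[OF z]) (auto simp: less_eq_lsc01.rep_eq u intro: SUP_upper)
  then show ?thesis using lsc01_levelD[OF _ c, of u] by (auto simp: u less_SUP_iff)
qed

lemma seq_sup_lsc01I:
  assumes "\<And>n. z n \<le> s"
    and "\<And>x c. x \<in> {0..1} \<Longrightarrow> enat c < Rep_lsc01 s x \<Longrightarrow> \<exists>n. enat c < Rep_lsc01 (z n) x"
  shows "seq_sup z s"
proof (rule seq_supI)
  fix u assume "\<And>n. z n \<le> u"
  then show "s \<le> u"
    using assms(2) by (intro lsc01_le_if_levels) (meson lsc01_levelD)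
qed (rule assms(1))

lemma seq_sup_add_lsc01:
  fixes s t :: lsc01
  assumes u: "increasing u" "seq_sup u s" and v: "increasing v" "seq_sup v t"
  shows "seq_sup (\<lambda>n. u n + v n) (s + t)"
proof (rule seq_sup_lsc01I)
  show "u n + v n \<le> s + t" for n
    using u(2) v(2) by (intro add_mono seq_sup_upper)
next
  have reach: "\<exists>n. enat a \<le> Rep_lsc01 (w n) x"
    if "seq_sup w r" "enat a \<le> Rep_lsc01 r x" for w r a x
  proof (cases a)
    case (Suc k)
    then show ?thesis using seq_sup_lsc01_level[OF that(1), of "enat k" x] that(2)
      by (simp add: Suc_ile_eq)
  qed (simp add: zero_enat_def[symmetric])
  fix x c assume "enat c < Rep_lsc01 (s + t) x"
  then have "enat c < Rep_lsc01 s x + Rep_lsc01 t x" by (simp add: plus_lsc01.rep_eq)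
  \<comment> \<open>A finite level below the sum is split between the summands; an infinite summand
    takes all of \<open>Suc c\<close>.\<close>
  then obtain a b where ab: "c < a + b" "enat a \<le> Rep_lsc01 s x" "enat b \<le> Rep_lsc01 t x"
  proof (cases "Rep_lsc01 s x"; cases "Rep_lsc01 t x")
    fix i j assume "Rep_lsc01 s x = enat i" "Rep_lsc01 t x = enat j"
    then show thesis using that[of i j] \<open>enat c < Rep_lsc01 s x + Rep_lsc01 t x\<close> by simp
  next
    fix i assume "Rep_lsc01 s x = enat i" "Rep_lsc01 t x = \<infinity>"
    then show thesis using that[of 0 "Suc c"] by simp
  next
    assume "Rep_lsc01 s x = \<infinity>"
    then show thesis using that[of "Suc c" 0] by (simp add: zero_enat_def[symmetric])
  qed (simp_all add: that[of "Suc c" 0] zero_enat_def[symmetric])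
  obtain m n where mn: "enat a \<le> Rep_lsc01 (u m) x" "enat b \<le> Rep_lsc01 (v n) x"
    using reach[OF u(2) ab(2)] reach[OF v(2) ab(3)] by blast
  let ?k = "max m n"
  have "u m \<le> u ?k" "v n \<le> v ?k" using u(1) v(1) by (simp_all add: monotoneD)
  then have "enat a + enat b \<le> Rep_lsc01 (u ?k) x + Rep_lsc01 (v ?k) x"
    using mn by (intro add_mono) (auto simp: less_eq_lsc01.rep_eq intro: order_trans)
  then have "enat c < Rep_lsc01 (u ?k + v ?k) x"
    using ab(1) by (simp add: plus_lsc01.rep_eq) (meson enat_ord_simps(2) less_le_trans)
  then show "\<exists>n. enat c < Rep_lsc01 (u n + v n) x" ..
qed

lemma Rep_sum: "Rep_lsc01 (sum h I) x = (\<Sum>i\<in>I. Rep_lsc01 (h i) x)"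
  by (induction I rule: infinite_finite_induct) (auto simp: zero_lsc01.rep_eq plus_lsc01.rep_eq)

text \<open>Total on sets, so that rays, components and superlevel sets share one notation; the
  value is controlled when the trace of \<open>U\<close> on [0,1] is relatively open.\<close>

definition chi :: "real set \<Rightarrow> lsc01"
  where "chi U = Abs_lsc01 (indicator ({0..1} \<inter> U))"

lemma Rep_chi:
  "openin (top_of_set {0..1}) ({0..1} \<inter> U) \<Longrightarrow> Rep_lsc01 (chi U) = indicator ({0..1} \<inter> U)"
  unfolding chi_def by (subst Abs_lsc01_inverse) (auto simp: lower_semicontinuous_on_indicator)

lemma chi_above_eq: "chi_above t = chi {t<..}"
  by (simp add: chi_def chi_above_def)

lemma lsc_unit_eq: "lsc_unit = chi UNIV"
  by (simp add: chi_def lsc_unit_def)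

lemma openin_ray [simp]:
  "openin (top_of_set {0..1}) ({0..1} \<inter> {t::real<..})"
  "openin (top_of_set {0..1}) ({0..1} \<inter> {..<t::real})"
  by (auto intro: openin_open_Int)

lemma enat_less_indicator_iff: "enat c < indicator A x \<longleftrightarrow> c = 0 \<and> x \<in> A"
  by (auto simp: indicator_def one_enat_def zero_enat_def)

section \<open>Shrinking\<close>

lift_definition shrink :: "enat \<Rightarrow> real \<Rightarrow> lsc01 \<Rightarrow> lsc01"
  is "\<lambda>n d f x. if x \<in> {0..1} then min n (INF y\<in>cball x d \<inter> {0..1}. f y) else 0"
proof -
  fix n :: enat and d and f :: "real \<Rightarrow> enat"
  assume f: "lower_semicontinuous_on {0..1} f \<and> (\<forall>x. x \<notin> {0..1} \<longrightarrow> f x = 0)"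
  let ?g = "\<lambda>x. if x \<in> {0..1} then min n (INF y\<in>cball x d \<inter> {0..1}. f y) else 0"
  have "openin (top_of_set {0..1}) {x \<in> {0..1}. c < ?g x}" for c
  proof (cases "c < n")
    case True
    then obtain k where k: "c = enat k" by (cases c) auto
    let ?K = "{y \<in> {0..1}. f y \<le> c}"
    have "closedin (top_of_set {0..1}) ({0..1} - {x \<in> {0..1}. c < f x})"
      using f by (intro closedin_diff closedin_subtopology_refl[THEN iffD2])
        (auto simp: lower_semicontinuous_on_def)
    moreover have "{0..1} - {x \<in> {0..1}. c < f x} = ?K" by auto
    ultimately have "compact ?K"
      using closedin_compact[OF compact_Icc, of "0::real" 1 ?K] by simp
    \<comment> \<open>A point fails level \<open>c\<close> exactly when it lies within
      \<open>d\<close> of the compact sublevel set \<open>?K\<close>; this neighbourhood is a sum of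
      two compact sets, hence closed.\<close>
    then have cl: "closed {y + z |y z. y \<in> ?K \<and> z \<in> cball 0 d}"
      by (intro compact_imp_closed compact_sums) auto
    have "{x \<in> {0..1}. c < ?g x} = {0..1} \<inter> - {y + z |y z. y \<in> ?K \<and> z \<in> cball 0 d}"
    proof (intro set_eqI iffI)
      fix x assume "x \<in> {x \<in> {0..1}. c < ?g x}"
      then have x: "x \<in> {0..1}" and *: "c < (INF y\<in>cball x d \<inter> {0..1}. f y)" by (auto split: if_splits)
      have "c < f y" if "y \<in> {0..1}" "dist x y \<le> d" for y
        using less_INF_D[OF *, of y] that by auto
      then show "x \<in> {0..1} \<inter> - {y + z |y z. y \<in> ?K \<and> z \<in> cball 0 d}"
        using x by (force simp: dist_real_def)
    next
      fix x assume x: "x \<in> {0..1} \<inter> - {y + z |y z. y \<in> ?K \<and> z \<in> cball 0 d}"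
      have "c < f y" if y: "y \<in> cball x d \<inter> {0..1}" for y
      proof (rule ccontr)
        assume "\<not> c < f y"
        then have "y \<in> ?K" "x - y \<in> cball 0 d" "x = y + (x - y)"
          using y by (auto simp: dist_real_def)
        then show False using x by blast
      qed
      \<comment> \<open>Strictness survives the infimum because the values are integers or
        \<infinity>.\<close>
      then have "enat (Suc k) \<le> (INF y\<in>cball x d \<inter> {0..1}. f y)"
        by (intro INF_greatest) (simp add: k Suc_ile_eq)
      then have "c < (INF y\<in>cball x d \<inter> {0..1}. f y)" by (simp add: k Suc_ile_eq)
      then show "x \<in> {x \<in> {0..1}. c < ?g x}" using x True by auto
    qed
    then show ?thesis using cl by (simp add: openin_open_Int open_Compl)
  next
    case False
    then have "{x \<in> {0..1}. c < ?g x} = {}" by auto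
    then show ?thesis by (simp only: openin_empty)
  qed
  then show "lower_semicontinuous_on {0..1} ?g \<and> (\<forall>x. x \<notin> {0..1} \<longrightarrow> ?g x = 0)"
    by (simp add: lower_semicontinuous_on_def)
qed

lemma shrink_level_iff:
  assumes "x \<in> {0..1}"
  shows "enat c < Rep_lsc01 (shrink n d f) x \<longleftrightarrow>
    enat c < n \<and> (\<forall>y\<in>{0..1}. dist x y \<le> d \<longrightarrow> enat c < Rep_lsc01 f y)"
proof -
  have "enat c < (INF y\<in>cball x d \<inter> {0..1}. Rep_lsc01 f y) \<longleftrightarrow>
      enat (Suc c) \<le> (INF y\<in>cball x d \<inter> {0..1}. Rep_lsc01 f y)"
    by (simp add: Suc_ile_eq)
  also have "\<dots> \<longleftrightarrow> (\<forall>y\<in>{0..1}. dist x y \<le> d \<longrightarrow> enat c < Rep_lsc01 f y)"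
    by (auto simp: le_INF_iff Suc_ile_eq)
  finally show ?thesis using assms by (simp add: shrink.rep_eq)
qed

lemma shrink_chi_level_iff:
  assumes "x \<in> {0..1}" "openin (top_of_set {0..1}) ({0..1} \<inter> U)"
  shows "enat c < Rep_lsc01 (shrink 1 r (chi U)) x \<longleftrightarrow>
    c = 0 \<and> (\<forall>y\<in>{0..1}. dist x y \<le> r \<longrightarrow> y \<in> U)"
proof -
  have "enat c < 1 \<longleftrightarrow> c = 0" by (simp add: one_enat_def)
  then show ?thesis
    unfolding shrink_level_iff[OF assms(1)] Rep_chi[OF assms(2)] enat_less_indicator_iff by auto
qed

section \<open>Order and addition under shrinking\<close>

lemma shrink_le: "0 \<le> d \<Longrightarrow> shrink n d f \<le> f"
  by (rule lsc01_le_if_levels) (auto simp: shrink_level_iff)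

lemma shrink_mono: "n \<le> m \<Longrightarrow> e \<le> d \<Longrightarrow> f \<le> g \<Longrightarrow> shrink n d f \<le> shrink m e g"
  by (rule lsc01_le_if_levels) (fastforce simp: shrink_level_iff intro: lsc01_levelD less_le_trans)

text \<open>Triangle inequality: a point within \<open>e\<close> of a point within \<open>d\<close>
  of \<open>x\<close> lies within \<open>d + e\<close> of \<open>x\<close>. The outer cap
  \<open>m\<close> cuts nothing off.\<close>

lemma shrink_shrink: "n \<le> m \<Longrightarrow> shrink n (d + e) f \<le> shrink m d (shrink n e f)"
proof (rule lsc01_le_if_levels)
  fix x c assume nm: "n \<le> m" and x: "x \<in> {0..1}" and c: "enat c < Rep_lsc01 (shrink n (d + e) f) x"
  have "enat c < Rep_lsc01 f w"
    if "y \<in> {0..1}" "dist x y \<le> d" "w \<in> {0..1}" "dist y w \<le> e" for y w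
    using c x that dist_triangle[of x w y] by (auto simp: shrink_level_iff)
  with c x nm show "enat c < Rep_lsc01 (shrink m d (shrink n e f)) x"
    by (auto simp: shrink_level_iff)
qed

lemma shrink_add: "shrink n d f + shrink m d g \<le> shrink (n + m) d (f + g)"
  by (rule lsc01_leI)
    (auto simp: shrink.rep_eq plus_lsc01.rep_eq simp del: min_less_iff_conj
      intro!: min.boundedI INF_greatest add_mono[OF min.cobounded1 min.cobounded1]
        add_mono[OF min.coboundedI2[OF INF_lower] min.coboundedI2[OF INF_lower]])

text \<open>The infimum only sees points of [0,1], so shrinking does not erode the unit at the
  endpoints. Hence the unit is way below itself and keeps its value in the limit.\<close>

lemma lsc_unit_le_shrink: "1 \<le> n \<Longrightarrow> lsc_unit \<le> shrink n d lsc_unit"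
proof (rule lsc01_le_if_levels)
  fix x c assume n: "1 \<le> n" and x: "x \<in> {0..1}" and c: "enat c < Rep_lsc01 lsc_unit x"
  from c have "c = 0" by (simp add: lsc_unit.rep_eq enat_less_indicator_iff)
  moreover from n have "enat 0 < n" by (simp add: Suc_ile_eq one_enat_def)
  ultimately show "enat c < Rep_lsc01 (shrink n d lsc_unit) x"
    unfolding shrink_level_iff[OF x] by (simp add: lsc_unit.rep_eq zero_enat_def[symmetric])
qed

text \<open>Turns estimates for shrunk functions back into the inequalities between rays that define
  the distance.\<close>

lemma chi_above_le_shrink:
  "0 \<le> d \<Longrightarrow> chi_above (t + d) \<le> shrink 1 d (chi_above t)"
proof (rule lsc01_le_if_levels)
  fix x c assume x: "x \<in> {0..1}" and c: "enat c < Rep_lsc01 (chi_above (t + d)) x"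
  from c have "c = 0" "t + d < x" by (simp_all add: chi_above.rep_eq enat_less_indicator_iff)
  moreover from this have "t < y" if "dist x y \<le> d" for y
    using that by (simp add: dist_real_def)
  moreover have "enat 0 < 1" by (simp add: zero_enat_def[symmetric])
  ultimately show "enat c < Rep_lsc01 (shrink 1 d (chi_above t)) x"
    unfolding shrink_level_iff[OF x] by (simp add: chi_above.rep_eq enat_less_indicator_iff)
qed

lemma seq_sup_uncapped_shrink: "seq_sup (\<lambda>n. shrink (enat n) d f) (shrink \<infinity> d f)"
proof (rule seq_sup_lsc01I)
  fix x c assume "x \<in> {0..1::real}" "enat c < Rep_lsc01 (shrink \<infinity> d f) x"
  then show "\<exists>n. enat c < Rep_lsc01 (shrink (enat n) d f) x"
    by (intro exI[of _ "Suc c"]) (auto simp: shrink_level_iff)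
qed (simp add: shrink_mono)

section \<open>Approximation by shrunk functions\<close>

lemma lsc01_level_nhd:
  assumes "x \<in> {0..1}" "c < Rep_lsc01 f x"
  obtains e where "e > 0" "\<And>y. y \<in> {0..1} \<Longrightarrow> dist x y < e \<Longrightarrow> c < Rep_lsc01 f y"
proof -
  have "\<exists>e>0. \<forall>y\<in>{0..1}. dist y x < e \<longrightarrow> y \<in> {x \<in> {0..1}. c < Rep_lsc01 f x}"
    using openin_superlevel[of c f] assms unfolding openin_euclidean_subtopology_iff by blast
  then obtain e where "e > 0" "\<forall>y\<in>{0..1}. dist y x < e \<longrightarrow> y \<in> {x \<in> {0..1}. c < Rep_lsc01 f x}"
    by blast
  then show ?thesis using that[of e] by (simp add: dist_commute)
qed

text \<open>By lower semicontinuity a level attained at \<open>x\<close> is attained on a whole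
  neighbourhood, which contains the ball of radius \<open>d n\<close> once \<open>n\<close> is
  large.\<close>

lemma seq_sup_shrink:
  assumes d: "d \<longlonglongrightarrow> 0" "\<And>n. 0 \<le> d n"
  shows "seq_sup (\<lambda>n. shrink (enat n) (d n) f) f"
proof (rule seq_sup_lsc01I)
  fix x c assume x: "x \<in> {0..1}" and c: "enat c < Rep_lsc01 f x"
  obtain e where e: "e > 0" "\<And>y. y \<in> {0..1} \<Longrightarrow> dist x y < e \<Longrightarrow> enat c < Rep_lsc01 f y"
    using lsc01_level_nhd[OF x c] by metis
  have "\<forall>\<^sub>F n in sequentially. c < n \<and> d n < e"
    using order_tendstoD(2)[OF d(1) e(1)] eventually_gt_at_top[of c] by eventually_elim auto
  then obtain n where "c < n" "d n < e" using eventually_happens'[OF sequentially_bot] by blast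
  then show "\<exists>n. enat c < Rep_lsc01 (shrink (enat n) (d n) f) x"
    using x e(2) by (intro exI[of _ n]) (auto simp: shrink_level_iff)
qed (simp add: shrink_le d)

lemma shrink_way_below:
  assumes "0 < d" shows "shrink (enat n) d f \<lless> f"
  unfolding way_below_def
proof (intro allI impI)
  fix z s assume z: "increasing z" "seq_sup z s" and fs: "f \<le> s"
  have "\<exists>k. \<forall>x\<in>{0..1}. (\<forall>y\<in>{0..1}. dist x y \<le> d \<longrightarrow> enat c < Rep_lsc01 f y) \<longrightarrow>
      enat c < Rep_lsc01 (z k) x" for c
  proof -
    \<comment> \<open>Removing open balls keeps \<open>K\<close> compact while it still contains
      every point surviving the closed-ball condition. As \<open>d > 0\<close>, \<open>f\<close>
      exceeds \<open>c\<close> on \<open>K\<close>, so the superlevel sets of the \<open>z k\<close>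
      cover it.\<close>
    define K where "K = {0..1} - (\<Union>y\<in>{y\<in>{0..1}. Rep_lsc01 f y \<le> enat c}. ball y d)"
    have "compact K"
      unfolding K_def by (intro compact_diff) auto
    have "openin (top_of_set {0..1}) {x \<in> {0..1}. enat c < Rep_lsc01 (z k) x}" for k
      by (rule openin_superlevel)
    then obtain T where T: "\<And>k. open (T k)"
      "\<And>k. {x \<in> {0..1}. enat c < Rep_lsc01 (z k) x} = {0..1} \<inter> T k"
      unfolding openin_open by metis
    have K: "x \<in> {0..1} \<and> enat c < Rep_lsc01 f x" if "x \<in> K" for x
      using that assms by (force simp: K_def)
    have "K \<subseteq> (\<Union>k. T k)"
    proof
      fix x assume "x \<in> K"
      with K have x: "x \<in> {0..1}" and "enat c < Rep_lsc01 s x" using fs lsc01_levelD by blast+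
      then obtain k where "enat c < Rep_lsc01 (z k) x" using seq_sup_lsc01_level[OF z(2)] by blast
      with x T(2)[of k] show "x \<in> (\<Union>k. T k)" by auto
    qed
    then obtain I where I: "finite I" "K \<subseteq> (\<Union>k\<in>I. T k)"
      using compactE_image[OF \<open>compact K\<close>, of UNIV T] T(1) by (metis (full_types))
    obtain N where N: "\<And>k. k \<in> I \<Longrightarrow> k \<le> N" using I(1) by (meson finite_nat_set_iff_bounded_le)
    show ?thesis
    proof (intro exI[of _ N] ballI impI)
      fix x :: real
      assume x: "x \<in> {0..1}" "\<forall>y\<in>{0..1}. dist x y \<le> d \<longrightarrow> enat c < Rep_lsc01 f y"
      then have "x \<in> K" by (force simp: K_def dist_commute)
      then obtain k where k: "k \<in> I" "x \<in> T k" using I by auto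
      then have "enat c < Rep_lsc01 (z k) x" using x T(2)[of k] by auto
      then show "enat c < Rep_lsc01 (z N) x"
        using N[OF k(1)] z(1) by (meson lsc01_levelD monotoneD)
    qed
  qed
  then obtain k where k: "\<And>c x. x \<in> {0..1} \<Longrightarrow>
      (\<forall>y\<in>{0..1}. dist x y \<le> d \<longrightarrow> enat c < Rep_lsc01 f y) \<Longrightarrow> enat c < Rep_lsc01 (z (k c)) x"
    by metis
  \<comment> \<open>The cap leaves only the levels below \<open>n\<close>, so one index serves all
    of them.\<close>
  obtain N where N: "\<And>c. c < n \<Longrightarrow> k c \<le> N"
    using finite_nat_set_iff_bounded_le[of "k ` {..<n}"] by auto
  have "shrink (enat n) d f \<le> z N"
  proof (rule lsc01_le_if_levels)
    fix x c assume x: "x \<in> {0..1}" "enat c < Rep_lsc01 (shrink (enat n) d f) x"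
    then have "c < n" "enat c < Rep_lsc01 (z (k c)) x" by (auto simp: shrink_level_iff k)
    then show "enat c < Rep_lsc01 (z N) x"
      using N z(1) by (meson lsc01_levelD monotoneD)
  qed
  then show "\<exists>n'. shrink (enat n) d f \<le> z n'" ..
qed

lemma lsc_unit_way_below: "lsc_unit \<lless> lsc_unit"
proof -
  have "lsc_unit \<le> shrink (enat 1) 1 lsc_unit"
    by (rule lsc_unit_le_shrink) (simp add: one_enat_def)
  then show ?thesis by (rule le_way_below_trans) (simp add: shrink_way_below)
qed

section \<open>Comparing two nearby morphisms\<close>

text \<open>The ray inequalities hold at a radius \<open>e\<close> strictly below \<open>d\<close>;
  the gap \<open>d - e\<close> upgrades inequalities to way-below relations, which weak cancellation
  requires.\<close>

locale close_morphisms =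
  fixes f g :: "lsc01 \<Rightarrow> 's::cu_semigroup" and e d :: real
  assumes f: "cu_morphism f" and g: "cu_morphism g"
    and unit: "f lsc_unit = g lsc_unit"
    and cancel: "weak_cancellation TYPE('s)"
    and e: "0 \<le> e" "e < d"
    and fg: "\<And>t. t \<in> {0..1} \<Longrightarrow> f (chi_above (t + e)) \<le> g (chi_above t)"
    and gf: "\<And>t. t \<in> {0..1} \<Longrightarrow> g (chi_above (t + e)) \<le> f (chi_above t)"
begin

lemma cancelD: "x + z \<lless> y + z \<Longrightarrow> x \<lless> (y::'s)"
  using cancel by (auto simp: weak_cancellation_def)

lemma unit_image_way_below: "f lsc_unit \<lless> g lsc_unit"
  using cu_morphism_way_below[OF f lsc_unit_way_below] by (simp add: unit)

text \<open>Replaces the ray estimates on a side where an interval reaches the end of [0,1].\<close>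

lemma whole_way_below: "f (shrink 1 d lsc_unit) \<lless> g lsc_unit"
  using e by (intro le_way_below_trans[OF cu_morphism_mono[OF f shrink_le] unit_image_way_below]) auto

lemma upper_ray_way_below:
  assumes a: "a \<in> {0..1}"
  shows "f (shrink 1 d (chi_above a)) \<lless> g (chi_above a)"
proof -
  have "shrink 1 d (chi_above a) \<le> shrink 1 (d - e) (chi_above (a + e))"
    unfolding chi_above_eq
  proof (rule lsc01_le_if_levels)
    fix x c assume x: "x \<in> {0..1}" and "enat c < Rep_lsc01 (shrink 1 d (chi {a<..})) x"
    then have c: "c = 0" and *: "\<And>y. y \<in> {0..1} \<Longrightarrow> dist x y \<le> d \<Longrightarrow> a < y"
      by (simp_all add: shrink_chi_level_iff)
    \<comment> \<open>This is the leftmost point of [0,1] within \<open>d\<close> of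
      \<open>x\<close>; \<open>0 \<le> a\<close> then excludes the value 0.\<close>
    have "a < max 0 (x - d)"
      using x e by (intro *) (auto simp: dist_real_def max_def)
    then have "a < x - d" using a by (simp add: less_max_iff_disj)
    then have "a + e < y" if "dist x y \<le> d - e" for y
      using that by (simp add: dist_real_def)
    with c x show "enat c < Rep_lsc01 (shrink 1 (d - e) (chi {a + e<..})) x"
      by (simp add: shrink_chi_level_iff)
  qed
  also have "\<dots> \<lless> chi_above (a + e)"
    using shrink_way_below[of "d - e" 1] e by (simp add: one_enat_def)
  finally (le_way_below_trans) have "f (shrink 1 d (chi_above a)) \<lless> f (chi_above (a + e))"
    by (rule cu_morphism_way_below[OF f])
  then show ?thesis using fg[OF a] by (rule way_below_le_trans)
qed

text \<open>Complementation: the shrunk ray [0, b) is disjoint from (b - d, 1], whereas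
  [0, b) and (b - d + e, 1] cover [0,1] since \<open>e < d\<close>. Comparing both with the unit and
  cancelling the image of (b - d, 1] gives the claim.\<close>

lemma lower_ray_way_below:
  assumes b: "b \<in> {0..1}"
  shows "f (shrink 1 d (chi {..<b})) \<lless> g (chi {..<b})"
proof -
  have *: "c = 0 \<and> x + d < b"
    if x: "x \<in> {0..1}" and c: "enat c < Rep_lsc01 (shrink 1 d (chi {..<b})) x" for x c
  proof -
    from x c have "c = 0" and *: "\<And>y. y \<in> {0..1} \<Longrightarrow> dist x y \<le> d \<Longrightarrow> y < b"
      by (simp_all add: shrink_chi_level_iff)
    have "min 1 (x + d) < b"
      using x e by (intro *) (auto simp: dist_real_def min_def)
    then show ?thesis using b \<open>c = 0\<close> by (simp add: min_less_iff_disj)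
  qed
  show ?thesis
  proof (cases "d \<le> b")
    \<comment> \<open>For \<open>b < d\<close> nothing survives the shrinking; otherwise
      \<open>b - d\<close> lies in [0,1], as \<open>gf\<close> demands.\<close>
    case False
    have "shrink 1 d (chi {..<b}) \<le> 0"
      by (rule lsc01_le_if_levels) (use * False in fastforce)
    then have "shrink 1 d (chi {..<b}) = 0"
      using zero_least order.antisym by blast
    then show ?thesis by (simp add: cu_morphism_zero[OF f] zero_way_below)
  next
    case True
    have "shrink 1 d (chi {..<b}) + chi_above (b - d) \<le> lsc_unit"
    proof (rule lsc01_leI)
      fix x :: real assume x: "x \<in> {0..1}"
      have "Rep_lsc01 (shrink 1 d (chi {..<b})) x \<le> indicator {..<b - d} x"
        by (intro enat_le_if_levels) (auto dest!: *[OF x] simp: less_diff_eq zero_enat_def[symmetric])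
      then show "Rep_lsc01 (shrink 1 d (chi {..<b}) + chi_above (b - d)) x \<le> Rep_lsc01 lsc_unit x"
        using x by (cases "x < b - d")
          (auto simp: plus_lsc01.rep_eq chi_above.rep_eq lsc_unit.rep_eq indicator_def)
    qed
    then have "f (shrink 1 d (chi {..<b})) + f (chi_above (b - d)) \<le> f lsc_unit"
      using cu_morphism_mono[OF f] by (simp add: cu_morphism_add[OF f, symmetric])
    moreover have "lsc_unit \<le> chi {..<b} + chi_above (b - d + e)"
      using e by (intro lsc01_leI) (auto simp: plus_lsc01.rep_eq chi_above.rep_eq lsc_unit.rep_eq
        Rep_chi indicator_def)
    then have "g lsc_unit \<le> g (chi {..<b}) + g (chi_above (b - d + e))"
      using cu_morphism_mono[OF g] by (simp add: cu_morphism_add[OF g, symmetric])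
    moreover have "g (chi_above (b - d + e)) \<le> f (chi_above (b - d))"
      using True b e by (intro gf) auto
    ultimately have "f (shrink 1 d (chi {..<b})) + f (chi_above (b - d)) \<lless>
        g (chi {..<b}) + f (chi_above (b - d))"
      by (meson add_left_mono order_trans le_way_below_trans way_below_le_trans unit_image_way_below)
    then show ?thesis by (rule cancelD)
  qed
qed

text \<open>If no point survives, the shrunk indicator is 0. Otherwise \<open>C\<close> is the
  intersection of a right ray \<open>A\<close> and a left ray \<open>B\<close>:
  \<open>chi A + chi B\<close> is at most \<open>chi C + lsc_unit\<close>, a surviving point gives
  the reverse estimate for the shrunk indicators, and the unit is cancelled.\<close>

lemma interval_way_below:
  assumes C: "openin (top_of_set {0..1}) C" "connected C"
  shows "f (shrink 1 d (chi C)) \<lless> g (chi C)"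
proof (cases "\<exists>x\<in>{0..1}. \<forall>y\<in>{0..1}. dist x y \<le> d \<longrightarrow> y \<in> C")
  case False
  have C01: "{0..1} \<inter> C = C" using openin_imp_subset[OF C(1)] by auto
  have "shrink 1 d (chi C) \<le> 0"
    using False C(1) by (intro lsc01_le_if_levels) (auto simp: shrink_chi_level_iff C01)
  then have "shrink 1 d (chi C) = 0"
    using zero_least order.antisym by blast
  then show ?thesis by (simp add: cu_morphism_zero[OF f] zero_way_below)
next
  case True
  then obtain x where x: "x \<in> {0..1}" and xC: "\<And>y. y \<in> {0..1} \<Longrightarrow> dist x y \<le> d \<Longrightarrow> y \<in> C"
    by blast
  have sub: "C \<subseteq> {0..1}" using openin_imp_subset[OF C(1)] .
  then have C01: "{0..1} \<inter> C = C" by auto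
  have xinC: "x \<in> C" using x xC e by simp
  have bdd: "bdd_below C" "bdd_above C" using sub by (auto intro: bdd_below_mono bdd_above_mono)
  have mem: "z \<in> C" if "u \<in> C" "v \<in> C" "u \<le> z" "z \<le> v" for u v z
    using C(2) that by (meson connected_contains_Icc atLeastAtMost_iff subsetD)
  \<comment> \<open>On a side where \<open>C\<close> contains the endpoint the whole interval is
    taken, because the open ray from \<open>Inf C = 0\<close> would lose the point 0.\<close>
  define A where "A = (if 0 \<in> C then UNIV else {Inf C<..})"
  define B where "B = (if 1 \<in> C then UNIV else {..<Sup C})"
  have "0 \<le> Inf C" "Inf C \<le> x" "x \<le> Sup C" "Sup C \<le> 1"
    using xinC sub bdd by (auto intro!: cInf_greatest cSup_least intro: cInf_lower cSup_upper)
  then have Inf01: "Inf C \<in> {0..1}" and Sup01: "Sup C \<in> {0..1}" using x by auto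
  have nhd: "\<exists>r>0. \<forall>y\<in>{0..1}. dist y u < r \<longrightarrow> y \<in> C" if "u \<in> C" for u
    using C(1) that unfolding openin_euclidean_subtopology_iff by blast
  \<comment> \<open>By relative openness, any point of \<open>C\<close> other than 0 has points of
    \<open>C\<close> to its left.\<close>
  have InfC: "Inf C \<notin> C" if "0 \<notin> C"
  proof
    assume inf: "Inf C \<in> C"
    with that have pos: "0 < Inf C" using Inf01 by (cases "Inf C = 0") auto
    obtain r where r: "r > 0" "\<And>y. y \<in> {0..1} \<Longrightarrow> dist y (Inf C) < r \<Longrightarrow> y \<in> C"
      using nhd[OF inf] by blast
    let ?y = "max 0 (Inf C - r / 2)"
    have "?y \<in> C" using r(1) pos Inf01 by (intro r(2)) (auto simp: dist_real_def max_def)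
    then have "Inf C \<le> ?y" using bdd(1) by (rule cInf_lower)
    then show False using r(1) pos by (auto simp: max_def split: if_splits)
  qed
  have SupC: "Sup C \<notin> C" if "1 \<notin> C"
  proof
    assume sup: "Sup C \<in> C"
    with that have pos: "Sup C < 1" using Sup01 by (cases "Sup C = 1") auto
    obtain r where r: "r > 0" "\<And>y. y \<in> {0..1} \<Longrightarrow> dist y (Sup C) < r \<Longrightarrow> y \<in> C"
      using nhd[OF sup] by blast
    let ?y = "min 1 (Sup C + r / 2)"
    have "?y \<in> C" using r(1) pos Sup01 by (intro r(2)) (auto simp: dist_real_def min_def)
    then have "?y \<le> Sup C" using bdd(2) by (rule cSup_upper)
    then show False using r(1) pos by (auto simp: min_def split: if_splits)
  qed
  have A: "z \<in> A \<longleftrightarrow> (\<exists>u\<in>C. u \<le> z)" if "z \<in> {0..1}" for z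
  proof (cases "0 \<in> C")
    case False
    have "Inf C < z" if "u \<in> C" "u \<le> z" for u
      using cInf_lower[OF that(1) bdd(1)] that InfC[OF False] by (cases "Inf C = u") auto
    moreover have "\<exists>u\<in>C. u \<le> z" if "Inf C < z"
      using that cInf_less_iff[of C z] xinC bdd(1) by (auto intro: less_imp_le)
    ultimately show ?thesis using False by (auto simp: A_def)
  qed (use that in \<open>auto simp: A_def\<close>)
  have B: "z \<in> B \<longleftrightarrow> (\<exists>u\<in>C. z \<le> u)" if "z \<in> {0..1}" for z
  proof (cases "1 \<in> C")
    case False
    have "z < Sup C" if "u \<in> C" "z \<le> u" for u
      using cSup_upper[OF that(1) bdd(2)] that SupC[OF False] by (cases "Sup C = u") auto
    moreover have "\<exists>u\<in>C. z \<le> u" if "z < Sup C"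
      using that less_cSup_iff[of C z] xinC bdd(2) by (auto intro: less_imp_le)
    ultimately show ?thesis using False by (auto simp: B_def)
  qed (use that in \<open>auto simp: B_def\<close>)
  have opA: "openin (top_of_set {0..1}) ({0..1} \<inter> A)"
    and opB: "openin (top_of_set {0..1}) ({0..1} \<inter> B)"
    by (auto simp: A_def B_def)
  have CAB: "z \<in> C \<longleftrightarrow> z \<in> A \<and> z \<in> B" if "z \<in> {0..1}" for z
    using A[OF that] B[OF that] mem by blast
  note levels = shrink_chi_level_iff[OF _ opA] shrink_chi_level_iff[OF _ opB]
    shrink_chi_level_iff[of _ C, unfolded C01, OF _ C(1)]
  have "f (shrink 1 d (chi A)) \<lless> g (chi A)"
    using upper_ray_way_below[OF Inf01] whole_way_below
    by (simp add: A_def chi_above_eq lsc_unit_eq)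
  moreover have "f (shrink 1 d (chi B)) \<lless> g (chi B)"
    using lower_ray_way_below[OF Sup01] whole_way_below
    by (simp add: B_def lsc_unit_eq)
  ultimately have "f (shrink 1 d (chi A)) + f (shrink 1 d (chi B)) \<lless> g (chi A) + g (chi B)"
    by (rule O3)
  moreover have "shrink 1 d (chi C) + lsc_unit \<le> shrink 1 d (chi A) + shrink 1 d (chi B)"
  proof (rule lsc01_leI)
    fix y :: real assume y: "y \<in> {0..1}"
    let ?s = "\<lambda>U. Rep_lsc01 (shrink 1 d (chi U)) y"
    have CA: "?s C \<le> ?s A" and CB: "?s C \<le> ?s B"
      by (intro enat_le_if_levels; use y CAB in \<open>auto simp: levels\<close>)+
    have 1: "1 \<le> ?s U" if "enat 0 < ?s U" for U
      using that by (simp add: one_enat_def Suc_ile_eq)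
    \<comment> \<open>To the right of the surviving point \<open>x\<close>, the ball around
      \<open>y\<close> stays in \<open>A\<close>: its points beyond \<open>x\<close> lie above an
      element of \<open>C\<close>, and those before \<open>x\<close> are within \<open>d\<close> of
      \<open>x\<close>. The left side is symmetric with \<open>B\<close>.\<close>
    have "1 \<le> ?s A \<or> 1 \<le> ?s B"
    proof (cases "x \<le> y")
      case True
      have "z \<in> A" if z: "z \<in> {0..1}" "dist y z \<le> d" for z
      proof (cases "x \<le> z")
        case True
        then show ?thesis using A[OF z(1)] xinC by blast
      next
        case False
        then have "z \<in> C" using z \<open>x \<le> y\<close> by (intro xC) (auto simp: dist_real_def)
        then show ?thesis using CAB[OF z(1)] by blast
      qed
      then show ?thesis using y by (intro disjI1 1) (simp add: levels)
    next
      case xy: False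
      have "z \<in> B" if z: "z \<in> {0..1}" "dist y z \<le> d" for z
      proof (cases "z \<le> x")
        case True
        then show ?thesis using B[OF z(1)] xinC by blast
      next
        case False
        then have "z \<in> C" using z xy by (intro xC) (auto simp: dist_real_def)
        then show ?thesis using CAB[OF z(1)] by blast
      qed
      then show ?thesis using y by (intro disjI2 1) (simp add: levels)
    qed
    \<comment> \<open>Whichever ray supplies the 1, the other one dominates
      \<open>?s C\<close>.\<close>
    then have "?s C + 1 \<le> ?s A + ?s B"
      using add_mono[OF CB, of 1 "?s A"] add_mono[OF CA, of 1 "?s B"] by (auto simp: add.commute)
    then show "Rep_lsc01 (shrink 1 d (chi C) + lsc_unit) y
        \<le> Rep_lsc01 (shrink 1 d (chi A) + shrink 1 d (chi B)) y"
      using y by (simp add: plus_lsc01.rep_eq lsc_unit.rep_eq)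
  qed
  then have "f (shrink 1 d (chi C)) + f lsc_unit \<le> f (shrink 1 d (chi A)) + f (shrink 1 d (chi B))"
    using cu_morphism_mono[OF f] by (simp add: cu_morphism_add[OF f, symmetric])
  moreover have "chi A + chi B \<le> chi C + lsc_unit"
    using CAB by (intro lsc01_leI)
      (auto simp: plus_lsc01.rep_eq lsc_unit.rep_eq Rep_chi[OF opA] Rep_chi[OF opB]
        Rep_chi[of C, unfolded C01, OF C(1)] indicator_def)
  then have "g (chi A) + g (chi B) \<le> g (chi C) + g lsc_unit"
    using cu_morphism_mono[OF g] by (simp add: cu_morphism_add[OF g, symmetric])
  ultimately have "f (shrink 1 d (chi C)) + f lsc_unit \<lless> g (chi C) + f lsc_unit"
    unfolding unit by (meson le_way_below_trans way_below_le_trans)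
  then show ?thesis by (rule cancelD)
qed

text \<open>Only finitely many components of \<open>U\<close> are long enough to survive shrinking, because such a
  component contains a point of a fixed grid.\<close>

lemma open_set_le:
  assumes U: "openin (top_of_set {0..1}) U"
  shows "f (shrink 1 d (chi U)) \<le> g (chi U)"
proof -
  have U01: "{0..1} \<inter> U = U" using openin_imp_subset[OF U] by auto
  obtain N :: nat where N: "0 < N" "1 / real N < d"
    using real_arch_inverse[of d] e by (auto simp: inverse_eq_divide)
  define comp where "comp = connected_component_set U"
  \<comment> \<open>Grid points outside \<open>U\<close> contribute the empty set, which is
    harmless.\<close>
  define \<C> where "\<C> = (\<lambda>k. comp (real k / real N)) ` {..N}"
  have fin: "finite \<C>" by (simp add: \<C>_def)
  have op: "openin (top_of_set {0..1}) C" and conn: "connected C" if "C \<in> \<C>" for C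
  proof -
    have "locally connected U"
      using U by (rule locally_open_subset[rotated]) (simp add: convex_imp_locally_connected)
    then have "openin (top_of_set U) C"
      using that by (auto simp: \<C>_def comp_def intro: openin_connected_component_locally_connected)
    then show "openin (top_of_set {0..1}) C" using U by (rule openin_trans)
    show "connected C" using that by (auto simp: \<C>_def comp_def)
  qed
  have op': "openin (top_of_set {0..1}) ({0..1} \<inter> C)" if "C \<in> \<C>" for C
    using op[OF that] openin_imp_subset[OF op[OF that]] by (simp add: Int_absorb1)
  have sub: "C \<subseteq> U" if "C \<in> \<C>" for C
    using that connected_component_subset[of U] unfolding \<C>_def comp_def by blast
  have disj: "C = D" if "C \<in> \<C>" "D \<in> \<C>" "x \<in> C" "x \<in> D" for C D x
    using that by (auto simp: \<C>_def comp_def) (metis connected_component_eq mem_Collect_eq)+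
  have "shrink 1 d (chi U) \<le> (\<Sum>C\<in>\<C>. shrink 1 d (chi C))"
  proof (rule lsc01_le_if_levels)
    fix x c assume x: "x \<in> {0..1}" and "enat c < Rep_lsc01 (shrink 1 d (chi U)) x"
    then have c: "c = 0" and near: "\<And>y. y \<in> {0..1} \<Longrightarrow> dist x y \<le> d \<Longrightarrow> y \<in> U"
      using U by (simp_all add: shrink_chi_level_iff U01)
    define k where "k = nat \<lfloor>x * real N\<rfloor>"
    have k: "real k \<le> x * real N" "x * real N < real k + 1" using x by (auto simp: k_def)
    let ?p = "real k / real N"
    have p: "?p \<le> x" "x \<le> ?p + 1 / real N"
      using k N(1) by (auto simp: field_simps)
    have "x * real N \<le> real N" using x by (simp add: mult_left_le_one_le)
    then have kN: "k \<le> N" using k(1) by linarith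
    \<comment> \<open>The ball around a surviving \<open>x\<close> is a connected part of
      \<open>U\<close> containing the grid point just left of \<open>x\<close>, so it lies in a
      single component from the family.\<close>
    have "connected ({0..1} \<inter> cball x d)"
      by (intro convex_connected convex_Int convex_cball) simp
    moreover have "?p \<in> {0..1} \<inter> cball x d"
      using p N x kN by (auto simp: dist_real_def)
    ultimately have "{0..1} \<inter> cball x d \<subseteq> comp ?p"
      unfolding comp_def using near by (intro connected_component_maximal) auto
    then have "\<forall>y\<in>{0..1}. dist x y \<le> d \<longrightarrow> y \<in> comp ?p" by auto
    moreover have C: "comp ?p \<in> \<C>" using kN by (auto simp: \<C>_def)
    ultimately have "enat 0 < Rep_lsc01 (shrink 1 d (chi (comp ?p))) x"
      using shrink_chi_level_iff[OF x op'[OF C]] by blast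
    also have "\<dots> \<le> Rep_lsc01 (\<Sum>C\<in>\<C>. shrink 1 d (chi C)) x"
      unfolding Rep_sum by (rule member_le_sum[OF C _ fin]) simp
    finally show "enat c < Rep_lsc01 (\<Sum>C\<in>\<C>. shrink 1 d (chi C)) x" by (simp add: c)
  qed
  then have "f (shrink 1 d (chi U)) \<le> (\<Sum>C\<in>\<C>. f (shrink 1 d (chi C)))"
    using cu_morphism_mono[OF f] by (simp add: cu_morphism_sum[OF f, symmetric])
  also have "\<dots> \<le> (\<Sum>C\<in>\<C>. g (chi C))"
    by (intro sum_mono way_below_imp_le interval_way_below op conn)
  also have "\<dots> = g (\<Sum>C\<in>\<C>. chi C)" by (simp add: cu_morphism_sum[OF g])
  also have "\<dots> \<le> g (chi U)"
  proof (intro cu_morphism_mono[OF g] lsc01_leI)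
    fix x :: real assume x: "x \<in> {0..1}"
    have "(\<Sum>C\<in>\<C>. indicator C x) \<le> (indicator U x :: enat)"
    proof (cases "\<exists>C\<in>\<C>. x \<in> C")
      case True
      then obtain C where C: "C \<in> \<C>" "x \<in> C" by blast
      \<comment> \<open>Distinct components are disjoint, so at most one summand is nonzero at
        \<open>x\<close>.\<close>
      then have "(\<Sum>D\<in>\<C> - {C}. indicator D x) = (0::enat)"
        using disj by (intro sum.neutral) (auto simp: indicator_def)
      moreover have "x \<in> U" using C sub by blast
      ultimately show ?thesis using C fin by (simp add: sum.remove)
    next
      case False
      then have "(\<Sum>C\<in>\<C>. indicator C x) = (0::enat)" by (intro sum.neutral) auto
      then show ?thesis by simp
    qed
    then show "Rep_lsc01 (\<Sum>C\<in>\<C>. chi C) x \<le> Rep_lsc01 (chi U) x"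
      using U x by (simp add: Rep_sum Rep_chi op' U01 indicator_inter_arith)
  qed
  finally show ?thesis .
qed

text \<open>Layer decomposition: a function capped at \<open>n\<close> is the sum of the indicators
  of its superlevel sets for levels below \<open>n\<close>, and each layer is an open set. Letting
  \<open>n\<close> grow removes the cap.\<close>

lemma shrink_image_le: "f (shrink \<infinity> d h) \<le> g h"
proof -
  define L where "L k = {x \<in> {0..1}. enat k < Rep_lsc01 h x}" for k
  have op: "openin (top_of_set {0..1}) (L k)" and L01: "{0..1} \<inter> L k = L k" for k
    unfolding L_def by (rule openin_superlevel, blast)
  have layers: "(\<Sum>k<n. if enat k < v then 1 else 0) = min (enat n) v" for n v
  proof (induction n)
    case (Suc n)
    show ?case
    proof (cases v)
      case (enat m)
      with Suc show ?thesis by (auto simp: min_def one_enat_def)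
    next
      case infinity
      then show ?thesis by (simp add: of_nat_eq_enat del: sum.lessThan_Suc of_nat_Suc)
    qed
  qed (simp add: zero_enat_def[symmetric])
  have "f (shrink (enat n) d h) \<le> g h" for n
  proof -
    have "shrink (enat n) d h \<le> (\<Sum>k<n. shrink 1 d (chi (L k)))"
    proof (rule lsc01_leI)
      fix x :: real assume x: "x \<in> {0..1}"
      let ?w = "Rep_lsc01 (shrink (enat n) d h) x"
      have "?w \<le> enat n" using x by (simp add: shrink.rep_eq)
      then have "?w = (\<Sum>k<n. if enat k < ?w then 1 else 0)" by (simp add: layers min_absorb2)
      also have "\<dots> \<le> (\<Sum>k<n. Rep_lsc01 (shrink 1 d (chi (L k))) x)"
      proof (rule sum_mono)
        fix k
        have "enat 0 < Rep_lsc01 (shrink 1 d (chi (L k))) x" if "enat k < ?w"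
          using that shrink_chi_level_iff[OF x, of "L k" 0 d] x op[of k]
          by (auto simp: shrink_level_iff L01) (auto simp: L_def)
        then show "(if enat k < ?w then 1 else 0) \<le> Rep_lsc01 (shrink 1 d (chi (L k))) x"
          by (auto simp: one_enat_def Suc_ile_eq)
      qed
      finally show "?w \<le> Rep_lsc01 (\<Sum>k<n. shrink 1 d (chi (L k))) x" by (simp add: Rep_sum)
    qed
    then have "f (shrink (enat n) d h) \<le> (\<Sum>k<n. f (shrink 1 d (chi (L k))))"
      using cu_morphism_mono[OF f] by (simp add: cu_morphism_sum[OF f, symmetric])
    also have "\<dots> \<le> (\<Sum>k<n. g (chi (L k)))" by (intro sum_mono open_set_le op)
    also have "\<dots> = g (\<Sum>k<n. chi (L k))" by (simp add: cu_morphism_sum[OF g])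
    also have "\<dots> \<le> g h"
    proof (intro cu_morphism_mono[OF g] lsc01_leI)
      fix x :: real assume x: "x \<in> {0..1}"
      have "Rep_lsc01 (\<Sum>k<n. chi (L k)) x = (\<Sum>k<n. if enat k < Rep_lsc01 h x then 1 else 0)"
        unfolding Rep_sum using x op by (intro sum.cong) (auto simp: Rep_chi L01, auto simp: L_def)
      then show "Rep_lsc01 (\<Sum>k<n. chi (L k)) x \<le> Rep_lsc01 h x" by (simp add: layers)
    qed
    finally show ?thesis .
  qed
  moreover have "seq_sup (\<lambda>n. f (shrink (enat n) d h)) (f (shrink \<infinity> d h))"
    by (intro cu_morphism_sup[OF f] seq_sup_uncapped_shrink) (auto simp: monotone_def shrink_mono)
  ultimately show ?thesis by (rule seq_sup_least[rotated])
qed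

end

section \<open>Direct sums\<close>

definition shrink_all :: "enat \<Rightarrow> real \<Rightarrow> ('r \<Rightarrow> lsc01) \<Rightarrow> 'r \<Rightarrow> lsc01"
  where "shrink_all n d F = (\<lambda>j. shrink n d (F j))"

lemma shrink_all_le: "0 \<le> d \<Longrightarrow> shrink_all n d F \<le> F"
  by (simp add: shrink_all_def le_fun_def shrink_le)

lemma shrink_all_mono: "n \<le> m \<Longrightarrow> e \<le> d \<Longrightarrow> F \<le> G \<Longrightarrow> shrink_all n d F \<le> shrink_all m e G"
  by (simp add: shrink_all_def le_fun_def shrink_mono)

lemma shrink_all_shrink_all:
  "n \<le> m \<Longrightarrow> shrink_all n (d + e) F \<le> shrink_all m d (shrink_all n e F)"
  by (simp add: shrink_all_def le_fun_def shrink_shrink)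

lemma shrink_all_add: "shrink_all n d F + shrink_all m d G \<le> shrink_all (n + m) d (F + G)"
  by (simp add: shrink_all_def le_fun_def shrink_add)

lemma seq_sup_shrink_all:
  assumes "d \<longlonglongrightarrow> 0" "\<And>n. 0 \<le> d n"
  shows "seq_sup (\<lambda>n. shrink_all (enat n) (d n) F) F"
  by (simp add: shrink_all_def seq_sup_fun_iff seq_sup_shrink assms)

lemma increasing_shrink_all:
  assumes "decseq d"
  shows "increasing (\<lambda>n. shrink_all (enat n) (d n) F)"
  using assms by (auto simp: monotone_def decseq_def intro!: shrink_all_mono)

text \<open>Each component reaches its bound at some index; finiteness of the index type allows
  taking the largest of them.\<close>

lemma finite_way_belowI:
  fixes F G :: "'r::finite \<Rightarrow> 'a::order"
  assumes "\<And>j. F j \<lless> G j"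
  shows "F \<lless> G"
  unfolding way_below_def
proof (intro allI impI)
  fix z and s :: "'r \<Rightarrow> 'a"
  assume z: "increasing z" "seq_sup z s" and G: "G \<le> s"
  have inc: "increasing (\<lambda>n. z n j)" for j using z(1) by (simp add: monotone_def le_fun_def)
  have "\<exists>n. F j \<le> z n j" for j
    using z(2) G by (intro way_belowD[OF assms inc]) (auto simp: seq_sup_fun_iff le_fun_def)
  then obtain n where n: "\<And>j. F j \<le> z (n j) j" by metis
  have "F j \<le> z (Max (range n)) j" for j
    using n[of j] monotoneD[OF inc[of j], of "n j" "Max (range n)"] by (meson Max_ge finite
      finite_imageI order_trans rangeI)
  then show "\<exists>n. F \<le> z n" by (auto simp: le_fun_def)
qed

lemma shrink_all_way_below:
  fixes F :: "'r::finite \<Rightarrow> lsc01"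
  shows "0 < d \<Longrightarrow> shrink_all (enat n) d F \<lless> F"
  unfolding shrink_all_def by (intro finite_way_belowI shrink_way_below)

lemma cu_morphism_summand_incl: "cu_morphism (summand_incl j)"
  unfolding cu_morphism_def
proof (intro conjI allI impI)
  fix x y :: lsc01 assume "x \<lless> y"
  show "summand_incl j x \<lless> summand_incl j y"
    unfolding way_below_def
  proof (intro allI impI)
    fix z s assume z: "increasing z" "seq_sup z s" and y: "summand_incl j y \<le> s"
    have "increasing (\<lambda>n. z n j)" using z(1) by (simp add: monotone_def le_fun_def)
    moreover have "seq_sup (\<lambda>n. z n j) (s j)" using z(2) by (simp add: seq_sup_fun_iff)
    moreover have "y \<le> s j" using le_funD[OF y, of j] by (simp add: summand_incl_def)
    ultimately obtain n where "x \<le> z n j" using way_belowD[OF \<open>x \<lless> y\<close>] by blast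
    then show "\<exists>n. summand_incl j x \<le> z n"
      by (intro exI[of _ n]) (auto simp: le_fun_def summand_incl_def zero_least)
  qed
qed (auto simp: summand_incl_def fun_eq_iff le_fun_def seq_sup_fun_iff,
    auto simp: seq_sup_def)

lemma sum_summand_incl:
  fixes F :: "'r::finite \<Rightarrow> lsc01"
  shows "(\<Sum>j\<in>UNIV. summand_incl j (F j)) = F"
  proof
  have apply_sum: "sum h I i = (\<Sum>j\<in>I. h j i)" for h :: "'r \<Rightarrow> 'r \<Rightarrow> lsc01" and I i
    by (induction I rule: infinite_finite_induct) auto
  show "(\<Sum>j\<in>UNIV. summand_incl j (F j)) i = F i" for i
    by (simp add: apply_sum summand_incl_def)
qed

section \<open>The distance\<close>

abbreviation close_radius :: "(lsc01 \<Rightarrow> 's::order) \<Rightarrow> (lsc01 \<Rightarrow> 's) \<Rightarrow> real \<Rightarrow> bool"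
  where "close_radius f g e \<equiv> e \<in> {0..1} \<and> (\<forall>t\<in>{0..1}.
    f (chi_above (t + e)) \<le> g (chi_above t) \<and> g (chi_above (t + e)) \<le> f (chi_above t))"

text \<open>The ray (t + 1, 1] is empty, so the set of admissible radii is nonempty and its infimum
  is meaningful.\<close>

lemma close_radius_one:
  assumes "cu_morphism f" "cu_morphism g"
  shows "close_radius f g 1"
proof -
  have "chi_above (t + 1) = 0" if "t \<in> {0..1}" for t
    using that by (intro order.antisym zero_least lsc01_leI) (simp add: chi_above.rep_eq)
  then show ?thesis using assms by (simp add: cu_morphism_zero zero_least)
qed

lemma cu_dist_interval_le: "close_radius f g e \<Longrightarrow> cu_dist_interval f g \<le> e"
  unfolding cu_dist_interval_def by (intro cInf_lower) (auto intro: bdd_belowI[of _ 0])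

lemma cu_dist_interval_less:
  assumes "cu_morphism f" "cu_morphism g" "cu_dist_interval f g < d"
  obtains e where "e < d" "close_radius f g e"
proof -
  have "Inf {e. close_radius f g e} < d" "{e. close_radius f g e} \<noteq> {}"
    using assms(3) close_radius_one[OF assms(1,2)] by (auto simp: cu_dist_interval_def)
  then obtain e where "e \<in> {e. close_radius f g e}" "e < d"
    using cInf_lessD[of "{e. close_radius f g e}" d] by meson
  then show ?thesis using that[of e] by simp
qed

lemma cu_dist_interval_nonneg:
  assumes "cu_morphism f" "cu_morphism g"
  shows "0 \<le> cu_dist_interval f g"
  unfolding cu_dist_interval_def
  using close_radius_one[OF assms] by (intro cInf_greatest) auto

lemma cu_dist_interval_le_cu_dist:
  fixes \<phi> :: "('r::finite \<Rightarrow> lsc01) \<Rightarrow> 's::order"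
  shows "cu_dist_interval (\<phi> \<circ> summand_incl j) (\<psi> \<circ> summand_incl j) \<le> cu_dist \<phi> \<psi>"
  unfolding cu_dist_def by (intro cSUP_upper) auto

lemma cu_dist_nonneg:
  fixes \<phi> :: "('r::finite \<Rightarrow> lsc01) \<Rightarrow> 's::cu_semigroup"
  assumes "cu_morphism \<phi>" "cu_morphism \<psi>"
  shows "0 \<le> cu_dist \<phi> \<psi>"
  using cu_dist_interval_nonneg cu_dist_interval_le_cu_dist cu_morphism_summand_incl
    cu_morphism_comp assms by (metis order_trans)

text \<open>Cap 1 suffices because indicators of rays take no value above 1.\<close>

lemma cu_dist_leI:
  fixes \<phi> :: "('r::finite \<Rightarrow> lsc01) \<Rightarrow> 's::cu_semigroup"
  assumes "e \<in> {0..1}" "\<And>F. \<phi> (shrink_all 1 e F) \<le> \<psi> F" "\<And>F. \<psi> (shrink_all 1 e F) \<le> \<phi> F"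
    and "mono \<phi>" "mono \<psi>"
  shows "cu_dist \<phi> \<psi> \<le> e"
  unfolding cu_dist_def
proof (rule cSUP_least)
  fix j :: 'r
  have le: "summand_incl j (chi_above (t + e)) \<le> shrink_all 1 e (summand_incl j (chi_above t))" for t
    using assms(1)
    by (simp add: shrink_all_def le_fun_def summand_incl_def chi_above_le_shrink zero_least)
  have "\<phi> (summand_incl j (chi_above (t + e))) \<le> \<psi> (summand_incl j (chi_above t))" for t
    by (rule order_trans[OF monoD[OF assms(4) le] assms(2)])
  moreover have "\<psi> (summand_incl j (chi_above (t + e))) \<le> \<phi> (summand_incl j (chi_above t))" for t
    by (rule order_trans[OF monoD[OF assms(5) le] assms(3)])
  ultimately show "cu_dist_interval (\<phi> \<circ> summand_incl j) (\<psi> \<circ> summand_incl j) \<le> e"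
    using assms(1) by (intro cu_dist_interval_le) simp
qed simp

text \<open>A one-sided form of closeness tested on all elements instead of rays. Leaving the
  shrinking uncapped lets the relation compose with radii simply adding up.\<close>

definition dominated :: "real \<Rightarrow> (('r \<Rightarrow> lsc01) \<Rightarrow> 's::order) \<Rightarrow> (('r \<Rightarrow> lsc01) \<Rightarrow> 's) \<Rightarrow> bool"
  where "dominated d \<phi> \<psi> \<longleftrightarrow> (\<forall>F. \<phi> (shrink_all \<infinity> d F) \<le> \<psi> F)"

lemma dominatedD: "dominated d \<phi> \<psi> \<Longrightarrow> \<phi> (shrink_all \<infinity> d F) \<le> \<psi> F"
  by (simp add: dominated_def)

lemma dominated_if_cu_dist_less:
  fixes \<phi> \<psi> :: "('r::finite \<Rightarrow> lsc01) \<Rightarrow> 's::cu_semigroup"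
  assumes cancel: "weak_cancellation TYPE('s)"
    and \<phi>: "cu_morphism \<phi>" and \<psi>: "cu_morphism \<psi>"
    and unit: "\<And>j. \<phi> (unit_at j) = \<psi> (unit_at j)"
    and d: "cu_dist \<phi> \<psi> < d"
  shows "dominated d \<phi> \<psi>" and "dominated d \<psi> \<phi>"
proof -
  have \<phi>j: "cu_morphism (\<phi> \<circ> summand_incl j)" and \<psi>j: "cu_morphism (\<psi> \<circ> summand_incl j)" for j
    by (intro cu_morphism_comp \<phi> \<psi> cu_morphism_summand_incl)+
  \<comment> \<open>The radius condition is symmetric, so one \<open>e\<close> serves both
    directions.\<close>
  have close: "\<exists>e. close_morphisms (\<phi> \<circ> summand_incl j) (\<psi> \<circ> summand_incl j) e d \<and>
      close_morphisms (\<psi> \<circ> summand_incl j) (\<phi> \<circ> summand_incl j) e d" for j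
  proof -
    obtain e where "e < d" "close_radius (\<phi> \<circ> summand_incl j) (\<psi> \<circ> summand_incl j) e"
      using cu_dist_interval_less[OF \<phi>j \<psi>j order_le_less_trans[OF cu_dist_interval_le_cu_dist d]]
      by blast
    then show ?thesis
      using \<phi>j \<psi>j cancel unit[of j]
      by (intro exI[of _ e]) (auto simp: close_morphisms_def unit_at_def)
  qed
  have "dominated d \<theta> \<eta>"
    if \<theta>: "cu_morphism \<theta>" and \<eta>: "cu_morphism \<eta>"
      and close: "\<And>j. \<exists>e. close_morphisms (\<theta> \<circ> summand_incl j) (\<eta> \<circ> summand_incl j) e d"
    for \<theta> \<eta> :: "('r \<Rightarrow> lsc01) \<Rightarrow> 's"
    unfolding dominated_def
  proof
    fix F
    have split: "(\<Sum>j\<in>UNIV. \<kappa> (summand_incl j (G j))) = \<kappa> G" if "cu_morphism \<kappa>"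
      for \<kappa> :: "('r \<Rightarrow> lsc01) \<Rightarrow> 's" and G
      by (simp add: cu_morphism_sum[OF that, symmetric] sum_summand_incl)
    have "(\<Sum>j\<in>UNIV. \<theta> (summand_incl j (shrink_all \<infinity> d F j))) \<le> (\<Sum>j\<in>UNIV. \<eta> (summand_incl j (F j)))"
    proof (rule sum_mono)
      fix j
      obtain e where "close_morphisms (\<theta> \<circ> summand_incl j) (\<eta> \<circ> summand_incl j) e d"
        using close by blast
      from close_morphisms.shrink_image_le[OF this, of "F j"]
      show "\<theta> (summand_incl j (shrink_all \<infinity> d F j)) \<le> \<eta> (summand_incl j (F j))"
        by (simp add: shrink_all_def)
    qed
    then show "\<theta> (shrink_all \<infinity> d F) \<le> \<eta> F" by (simp only: split[OF \<theta>] split[OF \<eta>])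
  qed
  then show "dominated d \<phi> \<psi>" "dominated d \<psi> \<phi>" using \<phi> \<psi> close by blast+
qed

lemma dominated_trans:
  assumes "dominated d \<phi> \<psi>" "dominated e \<psi> \<theta>" "mono \<phi>"
  shows "dominated (d + e) \<phi> \<theta>"
  unfolding dominated_def
proof
  fix F
  have "\<phi> (shrink_all \<infinity> (d + e) F) \<le> \<phi> (shrink_all \<infinity> d (shrink_all \<infinity> e F))"
    by (rule monoD[OF assms(3) shrink_all_shrink_all[OF order_refl]])
  also have "\<dots> \<le> \<psi> (shrink_all \<infinity> e F)" by (rule dominatedD[OF assms(1)])
  also have "\<dots> \<le> \<theta> F" by (rule dominatedD[OF assms(2)])
  finally show "\<phi> (shrink_all \<infinity> (d + e) F) \<le> \<theta> F" .
qed

lemma dominated_mono: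
  assumes "dominated d \<phi> \<psi>" "d \<le> e" "mono \<phi>"
  shows "dominated e \<phi> \<psi>"
  unfolding dominated_def
  using order_trans[OF monoD[OF assms(3) shrink_all_mono[OF order_refl assms(2) order_refl]]
    dominatedD[OF assms(1)]] by blast

lemma dominated_refl: "mono \<phi> \<Longrightarrow> dominated 0 \<phi> \<phi>"
  by (simp add: dominated_def monoD shrink_all_le)

lemma cu_morphism_imp_mono: "cu_morphism f \<Longrightarrow> mono f"
  by (simp add: monoI cu_morphism_mono)

text \<open>\<open>F\<close> is the supremum of its shrinkings and \<open>\<phi>\<close> preserves
  it, so bounds on the shrinkings pass to \<open>F\<close>. Applied in both directions this yields
  uniqueness.\<close>

lemma le_if_dominated:
  assumes \<phi>: "cu_morphism \<phi>" and dom: "\<And>d. 0 < d \<Longrightarrow> dominated d \<phi> \<psi>"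
  shows "\<phi> F \<le> \<psi> F"
proof -
  let ?F = "\<lambda>n. shrink_all (enat n) (1 / Suc n) F"
  have "seq_sup (\<lambda>n. \<phi> (?F n)) (\<phi> F)"
    by (intro cu_morphism_sup[OF \<phi>] increasing_shrink_all seq_sup_shrink_all LIMSEQ_Suc lim_1_over_n)
      (auto simp: decseq_def field_simps)
  moreover have "\<phi> (?F n) \<le> \<psi> F" for n
    using dominatedD[OF dom[of "1 / Suc n"], of F]
      cu_morphism_mono[OF \<phi> shrink_all_mono[of "enat n" \<infinity> "1 / Suc n" "1 / Suc n" F F]]
    by (auto intro: order_trans)
  ultimately show ?thesis by (rule seq_sup_least)
qed

section \<open>The limit morphism\<close>

text \<open>The step radii are differences of \<open>\<delta>\<close>, so they telescope: passing
  from index \<open>n\<close> to any later one costs less than \<open>\<delta> n\<close>.\<close>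

locale cauchy_morphisms =
  fixes \<phi> :: "nat \<Rightarrow> ('r::finite \<Rightarrow> lsc01) \<Rightarrow> 's::cu_semigroup" and \<delta> :: "nat \<Rightarrow> real"
  assumes morph: "cu_morphism (\<phi> n)"
    and \<delta>_pos: "0 < \<delta> n" and \<delta>_lim: "\<delta> \<longlonglongrightarrow> 0" and \<delta>_dec: "decseq \<delta>"
    and step: "dominated (\<delta> n - \<delta> (Suc n)) (\<phi> n) (\<phi> (Suc n))"
      "dominated (\<delta> n - \<delta> (Suc n)) (\<phi> (Suc n)) (\<phi> n)"
begin

lemma phi_mono: "mono (\<phi> n)"
  by (rule cu_morphism_imp_mono[OF morph])

lemma dominated_later:
  assumes "n \<le> m"
  shows "dominated (\<delta> n) (\<phi> n) (\<phi> m)" and "dominated (\<delta> n) (\<phi> m) (\<phi> n)"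
proof -
  have "dominated (\<delta> n - \<delta> m) (\<phi> n) (\<phi> m) \<and> dominated (\<delta> n - \<delta> m) (\<phi> m) (\<phi> n)"
    using assms
  proof (induction m rule: dec_induct)
    case base
    then show ?case using dominated_refl[OF phi_mono] by simp
  next
    case (step m)
    then show ?case
      using dominated_trans[of "\<delta> n - \<delta> m" "\<phi> n" "\<phi> m" "\<delta> m - \<delta> (Suc m)" "\<phi> (Suc m)"]
        dominated_trans[of "\<delta> m - \<delta> (Suc m)" "\<phi> (Suc m)" "\<phi> m" "\<delta> n - \<delta> m" "\<phi> n"]
        cauchy_morphisms.step[OF cauchy_morphisms_axioms] phi_mono
      by simp
  qed
  then show "dominated (\<delta> n) (\<phi> n) (\<phi> m)" "dominated (\<delta> n) (\<phi> m) (\<phi> n)"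
    using \<delta>_pos[of m] by (auto intro: dominated_mono[OF _ _ phi_mono])
qed

lemma \<delta>_small: "0 < e \<Longrightarrow> \<exists>n\<ge>k. \<delta> n < e"
  using order_tendstoD(2)[OF \<delta>_lim, of e] unfolding eventually_sequentially
  by (meson nat_le_linear order_trans)

definition approx :: "('r \<Rightarrow> lsc01) \<Rightarrow> nat \<Rightarrow> 's"
  where "approx F n = \<phi> n (shrink_all (enat n) (2 * \<delta> n) F)"

definition limit :: "('r \<Rightarrow> lsc01) \<Rightarrow> 's"
  where "limit F = (THE s. seq_sup (approx F) s)"

lemma increasing_approx: "increasing (approx F)"
proof (rule incseq_SucI)
  fix n
  let ?e = "\<delta> n - \<delta> (Suc n)"
  have "?e \<ge> 0" using \<delta>_dec by (simp add: decseq_SucD)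
  \<comment> \<open>Of the radius \<open>2 * \<delta> n\<close>, the part \<open>?e\<close> pays for
    passing to \<open>\<phi> (Suc n)\<close>; what remains is at least
    \<open>2 * \<delta> (Suc n)\<close>.\<close>
  have "shrink_all (enat n) (2 * \<delta> n) F \<le> shrink_all \<infinity> ?e (shrink_all (enat n) (\<delta> n + \<delta> (Suc n)) F)"
    using shrink_all_shrink_all[of "enat n" \<infinity> ?e "\<delta> n + \<delta> (Suc n)" F] by simp
  then have "approx F n \<le> \<phi> n (shrink_all \<infinity> ?e (shrink_all (enat n) (\<delta> n + \<delta> (Suc n)) F))"
    unfolding approx_def by (rule monoD[OF phi_mono])
  also have "\<dots> \<le> \<phi> (Suc n) (shrink_all (enat n) (\<delta> n + \<delta> (Suc n)) F)"
    by (rule dominatedD[OF step(1)])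
  also have "\<dots> \<le> approx F (Suc n)"
    unfolding approx_def using \<open>?e \<ge> 0\<close> by (intro monoD[OF phi_mono] shrink_all_mono) auto
  finally show "approx F n \<le> approx F (Suc n)" .
qed

lemma seq_sup_limit: "seq_sup (approx F) (limit F)"
proof -
  obtain s where s: "seq_sup (approx F) s" using O1[OF increasing_approx] by blast
  show ?thesis unfolding limit_def
    by (rule theI[of "seq_sup (approx F)", OF s]) (rule seq_sup_unique[OF _ s])
qed

text \<open>Of the radius \<open>e\<close>, the part \<open>\<delta> n\<close> pays for passing to a
  late \<open>\<phi> m\<close>; the rest exceeds \<open>2 * \<delta> m\<close>, so the result is
  below a term of the approximating sequence. With \<open>limit_le_image\<close> this sandwiches the
  limit by values of one \<open>\<phi> n\<close>.\<close>

lemma image_shrink_le_limit: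
  assumes e: "\<delta> n < e"
  shows "\<phi> n (shrink_all (enat k) e F) \<le> limit F"
proof -
  obtain m where m: "m \<ge> max n k" "\<delta> m < (e - \<delta> n) / 2"
    using \<delta>_small[of "(e - \<delta> n) / 2" "max n k"] e by auto
  let ?G = "shrink_all (enat k) (e - \<delta> n) F"
  have "\<phi> n (shrink_all (enat k) e F) \<le> \<phi> n (shrink_all \<infinity> (\<delta> n) ?G)"
    using shrink_all_shrink_all[of "enat k" \<infinity> "\<delta> n" "e - \<delta> n" F]
    by (intro monoD[OF phi_mono]) simp
  also have "\<dots> \<le> \<phi> m ?G"
    using m by (intro dominatedD[OF dominated_later(1)]) simp
  also have "\<dots> \<le> approx F m"
    unfolding approx_def using m by (intro monoD[OF phi_mono] shrink_all_mono) auto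
  also have "\<dots> \<le> limit F" by (rule seq_sup_upper[OF seq_sup_limit])
  finally show ?thesis .
qed

lemma limit_le_image:
  assumes F: "F \<le> shrink_all \<infinity> (\<delta> n) G"
  shows "limit F \<le> \<phi> n G"
proof (rule seq_sup_least[OF seq_sup_limit])
  fix k
  let ?m = "max n k"
  have "approx F k \<le> approx F ?m"
    using increasing_approx[of F] by (simp add: monotoneD)
  also have "\<dots> \<le> \<phi> ?m (shrink_all \<infinity> (\<delta> n) G)"
    unfolding approx_def using \<delta>_pos[of ?m] F
    by (intro monoD[OF phi_mono] order_trans[OF shrink_all_le F]) simp
  also have "\<dots> \<le> \<phi> n G" by (rule dominatedD[OF dominated_later(2)]) simp
  finally show "approx F k \<le> \<phi> n G" .
qed

section \<open>Cu-morphism properties of the limit\<close>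

lemma limit_mono: "F \<le> G \<Longrightarrow> limit F \<le> limit G"
proof (rule seq_sup_least[OF seq_sup_limit])
  fix n assume "F \<le> G"
  then have "approx F n \<le> approx G n"
    unfolding approx_def by (intro monoD[OF phi_mono] shrink_all_mono) auto
  also have "\<dots> \<le> limit G" by (rule seq_sup_upper[OF seq_sup_limit])
  finally show "approx F n \<le> limit G" .
qed

lemma limit_zero: "limit 0 = 0"
proof -
  have "0 \<le> shrink_all \<infinity> (\<delta> 0) (0 :: 'r \<Rightarrow> lsc01)" by (rule zero_least)
  then have "limit 0 \<le> \<phi> 0 0" by (rule limit_le_image)
  then show ?thesis using zero_least[of "limit 0"] by (simp add: cu_morphism_zero[OF morph])
qed

lemma limit_unit: "limit (unit_at j) = \<phi> n (unit_at j)"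
proof (rule order.antisym)
  have *: "unit_at j \<le> shrink_all m d (unit_at j)" if "1 \<le> m" for m d
    using lsc_unit_le_shrink[OF that]
    by (simp add: shrink_all_def le_fun_def unit_at_def summand_incl_def zero_least)
  show "limit (unit_at j) \<le> \<phi> n (unit_at j)"
    by (intro limit_le_image *) simp
  have "\<phi> n (unit_at j) \<le> \<phi> n (shrink_all (enat 1) (\<delta> n + 1) (unit_at j))"
    by (intro monoD[OF phi_mono] *) (simp add: one_enat_def)
  also have "\<dots> \<le> limit (unit_at j)" by (rule image_shrink_le_limit) simp
  finally show "\<phi> n (unit_at j) \<le> limit (unit_at j)" .
qed

lemma limit_sup:
  assumes z: "increasing z" "seq_sup z s"
  shows "seq_sup (\<lambda>k. limit (z k)) (limit s)"
proof (rule seq_supI)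
  show "limit (z k) \<le> limit s" for k
    by (intro limit_mono seq_sup_upper[OF z(2)])
next
  fix u assume u: "\<And>k. limit (z k) \<le> u"
  show "limit s \<le> u"
  proof (rule seq_sup_least[OF seq_sup_limit])
    fix n
    \<comment> \<open>Shrinking by \<open>\<delta> n / 2\<close> puts \<open>?G\<close> below some
      \<open>z k\<close>; the remaining radius \<open>3 / 2 * \<delta> n\<close> still exceeds
      \<open>\<delta> n\<close>.\<close>
    let ?G = "shrink_all (enat n) (\<delta> n / 2) s"
    have "?G \<lless> s" using \<delta>_pos[of n] by (intro shrink_all_way_below) simp
    then obtain k where k: "?G \<le> z k" using way_belowD[OF _ z order_refl] by blast
    have "shrink_all (enat n) (2 * \<delta> n) s \<le> shrink_all (enat n) (3 / 2 * \<delta> n) ?G"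
      using shrink_all_shrink_all[of "enat n" "enat n" "3 / 2 * \<delta> n" "\<delta> n / 2" s] by simp
    then have "approx s n \<le> \<phi> n (shrink_all (enat n) (3 / 2 * \<delta> n) ?G)"
      unfolding approx_def by (rule monoD[OF phi_mono])
    also have "\<dots> \<le> limit ?G" using \<delta>_pos[of n] by (intro image_shrink_le_limit) simp
    also have "\<dots> \<le> limit (z k)" by (rule limit_mono[OF k])
    also have "\<dots> \<le> u" by (rule u)
    finally show "approx s n \<le> u" .
  qed
qed

lemma limit_way_below:
  assumes FG: "F \<lless> G" shows "limit F \<lless> limit G"
proof -
  have "increasing (\<lambda>n. shrink_all (enat n) (\<delta> n) G)" "seq_sup (\<lambda>n. shrink_all (enat n) (\<delta> n) G) G"
    using \<delta>_dec \<delta>_lim \<delta>_pos by (simp_all add: increasing_shrink_all seq_sup_shrink_all less_imp_le)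
  then obtain k where k: "F \<le> shrink_all (enat k) (\<delta> k) G"
    using way_belowD[OF FG] by blast
  obtain n where n: "\<delta> n < \<delta> k / 4" using \<delta>_small[of "\<delta> k / 4" 0] \<delta>_pos[of k] by auto
  \<comment> \<open>The radius \<open>\<delta> k\<close> is split in three:
    \<open>\<delta> n\<close> for descending to \<open>\<phi> n\<close>,
    \<open>\<delta> k / 4\<close> for a way-below relation that \<open>\<phi> n\<close> preserves,
    and \<open>?b\<close>, which exceeds \<open>\<delta> n\<close>, for returning to the
    limit.\<close>
  let ?b = "\<delta> k - \<delta> n - \<delta> k / 4"
  let ?H = "shrink_all (enat k) ?b G"
  have "F \<le> shrink_all \<infinity> (\<delta> n) (shrink_all (enat k) (\<delta> k - \<delta> n) G)"
    using k shrink_all_shrink_all[of "enat k" \<infinity> "\<delta> n" "\<delta> k - \<delta> n" G] by simp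
  then have "limit F \<le> \<phi> n (shrink_all (enat k) (\<delta> k - \<delta> n) G)" by (rule limit_le_image)
  also have "\<dots> \<le> \<phi> n (shrink_all (enat k) (\<delta> k / 4) ?H)"
    using shrink_all_shrink_all[of "enat k" "enat k" "\<delta> k / 4" ?b G]
    by (intro monoD[OF phi_mono]) simp
  also have "\<dots> \<lless> \<phi> n ?H"
    using \<delta>_pos[of k] by (intro cu_morphism_way_below[OF morph] shrink_all_way_below) simp
  also (le_way_below_trans) have "\<phi> n ?H \<le> limit G"
    using n \<delta>_pos[of k] by (intro image_shrink_le_limit) simp
  finally (way_below_le_trans) show ?thesis .
qed

lemma limit_add: "limit (F + G) = limit F + limit G"
proof (rule order.antisym)
  have "seq_sup (\<lambda>n. approx F n + approx G n) (limit F + limit G)"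
    by (intro O4 increasing_approx seq_sup_limit)
  then show "limit F + limit G \<le> limit (F + G)"
  proof (rule seq_sup_least)
    fix n
    \<comment> \<open>The caps add up to \<open>n + n\<close>, still finite, as
      \<open>image_shrink_le_limit\<close> allows.\<close>
    have "approx F n + approx G n \<le> \<phi> n (shrink_all (enat (n + n)) (2 * \<delta> n) (F + G))"
      unfolding approx_def cu_morphism_add[OF morph, symmetric]
      using shrink_all_add[of "enat n" "2 * \<delta> n" F "enat n" G] by (intro monoD[OF phi_mono]) simp
    also have "\<dots> \<le> limit (F + G)" using \<delta>_pos[of n] by (intro image_shrink_le_limit) simp
    finally show "approx F n + approx G n \<le> limit (F + G)" .
  qed
next
  \<comment> \<open>\<open>F + G\<close> is the supremum of sums of shrunk functions and
    \<open>limit\<close> preserves it, so it suffices to bound \<open>limit\<close> on these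
    sums.\<close>
  let ?s = "\<lambda>n. shrink_all (enat n) (\<delta> n)"
  have inc: "increasing (\<lambda>n. ?s n H)" and sup: "seq_sup (\<lambda>n. ?s n H) H" for H :: "'r \<Rightarrow> lsc01"
    using \<delta>_dec \<delta>_lim \<delta>_pos by (simp_all add: increasing_shrink_all seq_sup_shrink_all less_imp_le)
  have "increasing (\<lambda>n. ?s n F + ?s n G)"
    using inc[of F] inc[of G] unfolding monotone_def by (meson add_mono)
  moreover have "seq_sup (\<lambda>n. ?s n F + ?s n G) (F + G)"
    using inc[of F] inc[of G] sup[of F] sup[of G]
    by (auto simp: seq_sup_fun_iff monotone_def le_fun_def intro!: seq_sup_add_lsc01)
  ultimately have "seq_sup (\<lambda>n. limit (?s n F + ?s n G)) (limit (F + G))"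
    by (rule limit_sup)
  then show "limit (F + G) \<le> limit F + limit G"
  proof (rule seq_sup_least)
    fix k
    \<comment> \<open>The choice of \<open>n\<close> makes \<open>\<delta> k - \<delta> n\<close>
      exceed \<open>\<delta> n\<close>, which the final comparison with the limit requires.\<close>
    obtain n where n: "\<delta> n < \<delta> k / 2" using \<delta>_small[of "\<delta> k / 2" 0] \<delta>_pos[of k] by auto
    let ?t = "shrink_all (enat k) (\<delta> k - \<delta> n)"
    have "?s k H \<le> shrink_all \<infinity> (\<delta> n) (?t H)" for H :: "'r \<Rightarrow> lsc01"
      using shrink_all_shrink_all[of "enat k" \<infinity> "\<delta> n" "\<delta> k - \<delta> n" H] by simp
    then have "?s k F + ?s k G \<le> shrink_all \<infinity> (\<delta> n) (?t F) + shrink_all \<infinity> (\<delta> n) (?t G)"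
      by (intro add_mono)
    also have "\<dots> \<le> shrink_all \<infinity> (\<delta> n) (?t F + ?t G)"
      using shrink_all_add[of \<infinity> "\<delta> n" "?t F" \<infinity> "?t G"] by simp
    finally have "limit (?s k F + ?s k G) \<le> \<phi> n (?t F + ?t G)" by (rule limit_le_image)
    also have "\<dots> = \<phi> n (?t F) + \<phi> n (?t G)" by (rule cu_morphism_add[OF morph])
    also have "\<dots> \<le> limit F + limit G"
      using n by (intro add_mono image_shrink_le_limit) auto
    finally show "limit (?s k F + ?s k G) \<le> limit F + limit G" .
  qed
qed

lemma cu_morphism_limit: "cu_morphism limit"
  unfolding cu_morphism_def
  by (simp add: limit_zero limit_add limit_mono limit_way_below limit_sup)

lemma cu_dist_limit: "(\<lambda>n. cu_dist limit (\<phi> n)) \<longlonglongrightarrow> 0"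
proof (rule tendsto_sandwich)
  show "\<forall>\<^sub>F n in sequentially. 0 \<le> cu_dist limit (\<phi> n)"
    by (simp add: cu_dist_nonneg cu_morphism_limit morph)
  \<comment> \<open>Ensures that \<open>2 * \<delta> n\<close> lies in [0,1] and is admissible as a
    radius.\<close>
  have "\<forall>\<^sub>F n in sequentially. \<delta> n < 1 / 2"
    using \<delta>_lim by (rule order_tendstoD) simp
  then show "\<forall>\<^sub>F n in sequentially. cu_dist limit (\<phi> n) \<le> 2 * \<delta> n"
  proof eventually_elim
    case (elim n)
    have "limit (shrink_all 1 (2 * \<delta> n) F) \<le> \<phi> n F" for F
      using \<delta>_pos[of n] by (intro limit_le_image shrink_all_mono) auto
    moreover have "\<phi> n (shrink_all 1 (2 * \<delta> n) F) \<le> limit F" for F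
      using image_shrink_le_limit[of n "2 * \<delta> n" 1 F] \<delta>_pos[of n] by (simp add: one_enat_def)
    ultimately show ?case
      using elim \<delta>_pos[of n] by (intro cu_dist_leI phi_mono monoI limit_mono) auto
  qed
  show "(\<lambda>n. 2 * \<delta> n) \<longlonglongrightarrow> 0" using tendsto_mult_right_zero[OF \<delta>_lim] .
qed simp

end

section \<open>Existence and uniqueness of the limit morphism\<close>

theorem theorem4p12:
  fixes \<phi> :: "nat \<Rightarrow> ('r::finite \<Rightarrow> lsc01) \<Rightarrow> 's::cu_semigroup"
    and \<epsilon> :: "nat \<Rightarrow> real"
  assumes "axiom_O5 TYPE('s)"
    and "weak_cancellation TYPE('s)"
    and "\<And>i. cu_morphism (\<phi> i)"
    and "\<And>i j. \<phi> i (unit_at j) = \<phi> (Suc i) (unit_at j)"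
    and "\<And>i. cu_dist (\<phi> i) (\<phi> (Suc i)) < \<epsilon> i"
    and "\<And>i. \<epsilon> (Suc i) < \<epsilon> i"
    and "summable \<epsilon>"
  shows "\<exists>!\<psi> :: ('r \<Rightarrow> lsc01) \<Rightarrow> 's. cu_morphism \<psi> \<and>
    (\<lambda>i. cu_dist \<psi> (\<phi> i)) \<longlonglongrightarrow> 0 \<and>
    (\<forall>i j. \<psi> (unit_at j) = \<phi> i (unit_at j))"
proof -
  note cancel = assms(2) and morph = assms(3) and unit = assms(4) and dist = assms(5)
  define \<delta> where "\<delta> n = (\<Sum>i. \<epsilon> (i + n))" for n
  have \<epsilon>_pos: "0 < \<epsilon> n" for n
    using cu_dist_nonneg[OF morph morph] dist by (rule order_le_less_trans)
  have summ: "summable (\<lambda>i. \<epsilon> (i + n))" for n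
    using assms(7) by (rule summable_ignore_initial_segment)
  have \<delta>_Suc: "\<delta> n = \<epsilon> n + \<delta> (Suc n)" for n
    using suminf_split_head[OF summ[of n]] by (simp add: \<delta>_def)
  interpret cauchy_morphisms \<phi> \<delta>
  proof
    show "0 < \<delta> n" for n
      unfolding \<delta>_def by (intro suminf_pos summ \<epsilon>_pos)
    show "\<delta> \<longlonglongrightarrow> 0"
      unfolding \<delta>_def by (rule suminf_exist_split2[OF assms(7)])
    show "decseq \<delta>"
    proof (rule decseq_SucI)
      show "\<delta> (Suc n) \<le> \<delta> n" for n using \<delta>_Suc[of n] \<epsilon>_pos[of n] by simp
    qed
    show "dominated (\<delta> n - \<delta> (Suc n)) (\<phi> n) (\<phi> (Suc n))"
      "dominated (\<delta> n - \<delta> (Suc n)) (\<phi> (Suc n)) (\<phi> n)" for n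
      using dominated_if_cu_dist_less[OF cancel morph morph unit dist] \<delta>_Suc[of n] by auto
  qed (fact morph)
  show ?thesis
  proof (rule ex1I[of _ limit])
    show "cu_morphism limit \<and> (\<lambda>i. cu_dist limit (\<phi> i)) \<longlonglongrightarrow> 0 \<and>
        (\<forall>i j. limit (unit_at j) = \<phi> i (unit_at j))"
      using cu_morphism_limit cu_dist_limit limit_unit by blast
    fix \<psi> :: "('r \<Rightarrow> lsc01) \<Rightarrow> 's"
    assume \<psi>: "cu_morphism \<psi> \<and> (\<lambda>i. cu_dist \<psi> (\<phi> i)) \<longlonglongrightarrow> 0 \<and>
        (\<forall>i j. \<psi> (unit_at j) = \<phi> i (unit_at j))"
    \<comment> \<open>Both morphisms are close to the same late \<open>\<phi> n\<close>; half of
      \<open>d\<close> pays for each passage.\<close>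
    have dom: "dominated d \<psi> limit \<and> dominated d limit \<psi>" if "0 < d" for d
    proof -
      have "\<forall>\<^sub>F n in sequentially. cu_dist \<psi> (\<phi> n) < d / 2 \<and> cu_dist limit (\<phi> n) < d / 2"
        using \<psi> cu_dist_limit that
        by (intro eventually_conj order_tendstoD) auto
      then obtain n where n: "cu_dist \<psi> (\<phi> n) < d / 2" "cu_dist limit (\<phi> n) < d / 2"
        using eventually_happens'[OF sequentially_bot] by blast
      have 1: "dominated (d / 2) \<psi> (\<phi> n)" "dominated (d / 2) (\<phi> n) \<psi>"
        using dominated_if_cu_dist_less[OF cancel _ morph _ n(1)] \<psi> by auto
      have 2: "dominated (d / 2) limit (\<phi> n)" "dominated (d / 2) (\<phi> n) limit"
        using dominated_if_cu_dist_less[OF cancel cu_morphism_limit morph limit_unit n(2)] by auto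
      show ?thesis
        using dominated_trans[OF 1(1) 2(2)] dominated_trans[OF 2(1) 1(2)] \<psi>
          cu_morphism_limit by (simp add: cu_morphism_imp_mono)
    qed
    show "\<psi> = limit"
    proof (intro ext order.antisym)
      fix F
      show "\<psi> F \<le> limit F" by (rule le_if_dominated[OF conjunct1[OF \<psi>] conjunct1[OF dom]])
      show "limit F \<le> \<psi> F" by (rule le_if_dominated[OF cu_morphism_limit conjunct2[OF dom]])
    qed
  qed
qed

end
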